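(* Let $V\mapsto\tau(V)=\widehat\tau(\log V)$, $\tau:\mathrm{Sym}^{++}(3)\to\mathrm{Sym}(3)$, be a continuously differentiable isotropic Cauchy-elastic constitutive law for the Kirchhoff stress $\tau=J\,\sigma$ (no stored energy is assumed). Then the following are equivalent: (i) for every continuously differentiable curve $t\mapsto F(t)\in\mathrm{GL}^+(3)$, with $V=\sqrt{FF^T}$ and $\tau=\tau(V)$ along the curve, $$\Big\langle \frac{\mathrm{D}^{\mathrm{ZJ}}}{\mathrm{D}t}[\tau],D\Big\rangle>0\quad\text{at every } t \text{ with } D(t)\neq0;$$ (ii) $\mathrm{sym}\,\mathrm{D}_{\log V}\widehat\tau(\log V)\in\mathrm{Sym}^{++}_4(6)$ for all $V\in\mathrm{Sym}^{++}(3)$. Moreover, these equivalent conditions imply Hill's inequality $$\big\langle\widehat\tau(\log V_1)-\widehat\tau(\log V_2),\log V_1-\log V_2\big\rangle>0\qquad\text{for all }V_1,V_2\in\mathrm{Sym}^{++}(3),\ V_1\neq V_2.$$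
   Context: $\mathrm{Sym}(3)$ is the space of real symmetric $3\times3$ matrices, $\mathrm{Sym}^{++}(3)$ the set of positive definite ones, $\langle X,Y\rangle=\mathrm{tr}(XY^T)$, and $\mathrm{GL}^+(3)$ is the set of real $3\times 3$ matrices with positive determinant. $\sigma$ is the Cauchy stress and $J=\det F=\det V$. $\log:\mathrm{Sym}^{++}(3)\to\mathrm{Sym}(3)$ is the principal matrix logarithm (a bijection), so $\widehat\tau:\mathrm{Sym}(3)\to\mathrm{Sym}(3)$ is defined by $\widehat\tau(\log V)=\tau(V)$. Isotropy means $\tau(QVQ^T)=Q\,\tau(V)\,Q^T$ for all $Q\in\mathrm{SO}(3)$, $V\in\mathrm{Sym}^{++}(3)$. For a curve $F(t)\in\mathrm{GL}^+(3)$ put $L=\dot F F^{-1}$, $D=\frac12(L+L^T)$ and $W=\frac12(L-L^T)$. The Zaremba-Jaumann rate is $$\frac{\mathrm{D}^{\mathrm{ZJ}}}{\mathrm{D}t}[\tau]=\frac{\mathrm d}{\mathrm dt}[\tau]+\tau W-W\tau .$$ $\mathrm{D}_{\log V}\widehat\tau(\log V)$ is the Fréchet derivative of $\widehat\tau$ at $\log V$, a linear map $\mathrm{Sym}(3)\to\mathrm{Sym}(3)$; $\mathrm{sym}$ of such a linear map is its self-adjoint part with respect to $\langle\cdot,\cdot\rangle$. $\mathrm{Sym}^{++}_4(6)$ is the set of self-adjoint linear maps $\mathbb{C}:\mathrm{Sym}(3)\to\mathrm{Sym}(3)$ with $\langle\mathbb{C}.H,H\rangle>0$ for all $H\in\mathrm{Sym}(3)\setminus\{0\}$.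 *)

theory Defs
  imports "HOL-Analysis.Analysis"
begin

type_synonym mat3 = "real^3^3"

(* The library inner product on real^3^3 is the Frobenius inner product tr(X Y^T). *)
lemma inner_eq_trace: "X \<bullet> Y = trace (X ** transpose Y)" for X Y :: mat3
  by (simp add: inner_vec_def trace_def matrix_matrix_mult_def transpose_def)

definition Sym :: "mat3 set"
  where "Sym = {X. transpose X = X}"

definition Sym_pp :: "mat3 set"
  where "Sym_pp = {V \<in> Sym. \<forall>x. x \<noteq> 0 \<longrightarrow> x \<bullet> (V *v x) > 0}"

definition GL_plus :: "mat3 set"
  where "GL_plus = {F. det F > 0}"


(* The multiplication and exp of the type class structure on vec are not usable here: the
   class multiplication is componentwise. *)
definition mat_pow :: "mat3 \<Rightarrow> nat \<Rightarrow> mat3"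
  where "mat_pow A k = (((**) A) ^^ k) (mat 1)"

definition mat_exp :: "mat3 \<Rightarrow> mat3"
  where "mat_exp A = (\<Sum>k. (1 / fact k) *\<^sub>R mat_pow A k)"

(* On Sym_pp the principal logarithm is the unique symmetric solution S of exp S = V:
   symmetry makes the spectrum of S real, hence contained in the strip |Im z| < pi.
   Only used on Sym_pp. *)
definition mat_log :: "mat3 \<Rightarrow> mat3"
  where "mat_log V = (THE S. S \<in> Sym \<and> mat_exp S = V)"

(* The positive definite square root; only used on Sym_pp. *)
definition mat_sqrt :: "mat3 \<Rightarrow> mat3"
  where "mat_sqrt B = (THE V. V \<in> Sym_pp \<and> V ** V = B)"

definition left_stretch :: "mat3 \<Rightarrow> mat3"
  where "left_stretch F = mat_sqrt (F ** transpose F)"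


(* For X = Sym_pp, which is open in the subspace Sym, the derivative within X is determined
   exactly on the directions in Sym. *)
definition C1_on :: "mat3 set \<Rightarrow> (mat3 \<Rightarrow> mat3) \<Rightarrow> bool"
  where "C1_on X f \<longleftrightarrow>
    (\<exists>f' :: mat3 \<Rightarrow> mat3 \<Rightarrow>\<^sub>L mat3.
      (\<forall>x\<in>X. (f has_derivative blinfun_apply (f' x)) (at x within X)) \<and> continuous_on X f')"

definition isotropic :: "(mat3 \<Rightarrow> mat3) \<Rightarrow> bool"
  where "isotropic \<tau> \<longleftrightarrow>
    (\<forall>Q. \<forall>V\<in>Sym_pp. rotation_matrix Q \<longrightarrow>
      \<tau> (Q ** V ** transpose Q) = Q ** \<tau> V ** transpose Q)"


definition velocity_gradient :: "(real \<Rightarrow> mat3) \<Rightarrow> real \<Rightarrow> mat3"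
  where "velocity_gradient F t = vector_derivative F (at t) ** matrix_inv (F t)"

definition stretching :: "(real \<Rightarrow> mat3) \<Rightarrow> real \<Rightarrow> mat3"
  where "stretching F t =
    (1/2) *\<^sub>R (velocity_gradient F t + transpose (velocity_gradient F t))"

definition vorticity :: "(real \<Rightarrow> mat3) \<Rightarrow> real \<Rightarrow> mat3"
  where "vorticity F t =
    (1/2) *\<^sub>R (velocity_gradient F t - transpose (velocity_gradient F t))"

definition ZJ_rate :: "(real \<Rightarrow> mat3) \<Rightarrow> (real \<Rightarrow> mat3) \<Rightarrow> real \<Rightarrow> mat3"
  where "ZJ_rate F T t =
    vector_derivative T (at t) + T t ** vorticity F t - vorticity F t ** T t"


(* Linear maps Sym(3) -> Sym(3) are represented by functions on mat3 of which only the
   restriction to Sym is meaningful. *)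

(* frechet_derivative selects some derivative within Sym; its values on directions in Sym
   do not depend on the selection, its values elsewhere do and are never used. *)
definition D_Sym :: "(mat3 \<Rightarrow> mat3) \<Rightarrow> mat3 \<Rightarrow> mat3 \<Rightarrow> mat3"
  where "D_Sym f S = frechet_derivative f (at S within Sym)"

definition adjoint_Sym :: "(mat3 \<Rightarrow> mat3) \<Rightarrow> mat3 \<Rightarrow> mat3"
  where "adjoint_Sym C K = (THE M. M \<in> Sym \<and> (\<forall>H\<in>Sym. C H \<bullet> K = H \<bullet> M))"

definition sym_part :: "(mat3 \<Rightarrow> mat3) \<Rightarrow> mat3 \<Rightarrow> mat3"
  where "sym_part C H = (1/2) *\<^sub>R (C H + adjoint_Sym C H)"

definition Sym4_pp :: "(mat3 \<Rightarrow> mat3) set"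
  where "Sym4_pp = {C.
    (\<forall>H\<in>Sym. C H \<in> Sym) \<and>
    (\<forall>H\<in>Sym. \<forall>K\<in>Sym. C (H + K) = C H + C K) \<and>
    (\<forall>c. \<forall>H\<in>Sym. C (c *\<^sub>R H) = c *\<^sub>R C H) \<and>
    (\<forall>H\<in>Sym. \<forall>K\<in>Sym. C H \<bullet> K = H \<bullet> C K) \<and>
    (\<forall>H\<in>Sym - {0}. C H \<bullet> H > 0)}"

end

theory Submission
  imports Defs
begin

text \<open>Write \<open>T\<close> for the derivative of \<open>\<tau>\<close> at \<open>V = exp S\<close>. By isotropy the spin drops out of the
  Zaremba-Jaumann rate, which becomes \<open>T K\<close> with \<open>K V + V K = D V\<^sup>2 + V\<^sup>2 D\<close>, while the derivative of
  \<open>\<tau>_hat\<close> at \<open>S\<close> in direction \<open>H\<close> is \<open>T\<close> applied to the derivative of the exponential. In an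
  eigenbasis of \<open>V\<close> the map \<open>D \<mapsto> K\<close> and the derivative of the exponential multiply the entries by positive factors that
  agree on the diagonal. Also \<open>T\<close> commutes with conjugation by the rotations
  \<open>diag(1,-1,-1)\<close>, \<open>diag(-1,1,-1)\<close>, \<open>diag(-1,-1,1)\<close>, so its quadratic form splits into a form in the
  diagonal entries and a multiple of the square of each off-diagonal entry. Hence both
  positivity conditions say that the diagonal form and the three off-diagonal coefficients are positive.
  Hill's inequality follows by integrating along segments in \<open>Sym\<close>.\<close>

subsection \<open>Diagonalization by plane rotations\<close>

lemma bounded_bilinear_matrix_mult: "bounded_bilinear ((**) :: mat3 \<Rightarrow> mat3 \<Rightarrow> mat3)"
proof -
  have "bilinear ((**) :: mat3 \<Rightarrow> mat3 \<Rightarrow> mat3)"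
    unfolding bilinear_def
    by (auto intro!: linearI simp: matrix_add_ldistrib matrix_matrix_mult_def vec_eq_iff
        sum.distrib algebra_simps sum_distrib_left)
  then show ?thesis by (simp add: bilinear_conv_bounded_bilinear)
qed

lemmas mm_has_vector_derivative =
  bounded_bilinear.has_vector_derivative[OF bounded_bilinear_matrix_mult]

lemma linear_transpose_mat3: "linear (transpose :: mat3 \<Rightarrow> mat3)"
  by (auto intro!: linearI simp: transpose_def vec_eq_iff)

lemma bounded_linear_transpose_mat3: "bounded_linear (transpose :: mat3 \<Rightarrow> mat3)"
  using linear_transpose_mat3 by (simp add: linear_conv_bounded_linear)

lemmas transpose_simps =
  linear_add[OF linear_transpose_mat3] linear_diff[OF linear_transpose_mat3]
  linear_cmul[OF linear_transpose_mat3] linear_neg[OF linear_transpose_mat3]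
  linear_0[OF linear_transpose_mat3] matrix_transpose_mul transpose_transpose

lemmas mm_simps =
  bounded_bilinear.add_left[OF bounded_bilinear_matrix_mult]
  bounded_bilinear.add_right[OF bounded_bilinear_matrix_mult]
  bounded_bilinear.diff_left[OF bounded_bilinear_matrix_mult]
  bounded_bilinear.diff_right[OF bounded_bilinear_matrix_mult]
  bounded_bilinear.minus_left[OF bounded_bilinear_matrix_mult]
  bounded_bilinear.minus_right[OF bounded_bilinear_matrix_mult]
  bounded_bilinear.scaleR_left[OF bounded_bilinear_matrix_mult]
  bounded_bilinear.scaleR_right[OF bounded_bilinear_matrix_mult]
  bounded_bilinear.zero_left[OF bounded_bilinear_matrix_mult]
  bounded_bilinear.zero_right[OF bounded_bilinear_matrix_mult]

lemma subspace_Sym: "subspace Sym"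
  by (auto simp: subspace_def Sym_def transpose_simps)

lemmas Sym_simps = subspace_0[OF subspace_Sym] subspace_add[OF subspace_Sym]
  subspace_diff[OF subspace_Sym] subspace_scale[OF subspace_Sym]

definition conj_mat :: "mat3 \<Rightarrow> mat3 \<Rightarrow> mat3"
  where "conj_mat Q A = Q ** A ** transpose Q"

definition diag_mat :: "real^3 \<Rightarrow> mat3"
  where "diag_mat d = (\<chi> i j. if i = j then d $ i else 0)"

lemma linear_conj_mat: "linear (conj_mat Q)"
  by (auto intro!: linearI simp: conj_mat_def mm_simps)

lemma bounded_linear_conj_mat: "bounded_linear (conj_mat Q)"
  using linear_conj_mat by (simp add: linear_conv_bounded_linear)

lemmas conj_mat_simps = linear_add[OF linear_conj_mat] linear_diff[OF linear_conj_mat]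
  linear_cmul[OF linear_conj_mat] linear_0[OF linear_conj_mat]

lemma conj_mat_mult:
  assumes "orthogonal_matrix Q"
  shows "conj_mat Q (A ** B) = conj_mat Q A ** conj_mat Q B"
proof -
  have "conj_mat Q A ** conj_mat Q B = Q ** A ** (transpose Q ** Q) ** B ** transpose Q"
    by (simp add: conj_mat_def matrix_mul_assoc)
  also have "transpose Q ** Q = mat 1"
    using assms by (simp add: orthogonal_matrix_def)
  finally show ?thesis
    by (simp add: conj_mat_def matrix_mul_assoc)
qed

lemma conj_mat_transpose: "transpose (conj_mat Q A) = conj_mat Q (transpose A)"
  by (simp add: conj_mat_def transpose_simps matrix_mul_assoc)

lemma conj_mat_conj_mat: "conj_mat P (conj_mat Q A) = conj_mat (P ** Q) A"
  by (simp add: conj_mat_def transpose_simps matrix_mul_assoc)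

lemma conj_mat_inverse:
  assumes "orthogonal_matrix Q"
  shows "conj_mat (transpose Q) (conj_mat Q A) = A" "conj_mat Q (conj_mat (transpose Q) A) = A"
  using assms unfolding conj_mat_conj_mat by (auto simp: conj_mat_def orthogonal_matrix_def transpose_simps)

lemma conj_mat_one: "orthogonal_matrix Q \<Longrightarrow> conj_mat Q (mat 1) = mat 1"
  by (simp add: conj_mat_def orthogonal_matrix_def)

lemma inner_mult_transpose:
  fixes A B C :: mat3
  shows "(A ** B) \<bullet> C = B \<bullet> (transpose A ** C)" "(A ** B) \<bullet> C = A \<bullet> (C ** transpose B)"
proof -
  show "(A ** B) \<bullet> C = B \<bullet> (transpose A ** C)"
    unfolding inner_eq_trace transpose_simps
    by (metis matrix_mul_assoc trace_mul_sym)
  show "(A ** B) \<bullet> C = A \<bullet> (C ** transpose B)"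
    unfolding inner_eq_trace transpose_simps by (simp add: matrix_mul_assoc)
qed

lemma inner_conj_mat:
  assumes "orthogonal_matrix Q"
  shows "conj_mat Q A \<bullet> B = A \<bullet> conj_mat (transpose Q) B"
  unfolding conj_mat_def inner_mult_transpose(2)[of "Q ** A"] inner_mult_transpose(1)[of Q]
  by (simp add: matrix_mul_assoc)

lemma inner_conj_mat_conj_mat:
  assumes "orthogonal_matrix Q"
  shows "conj_mat Q A \<bullet> conj_mat Q B = A \<bullet> B"
  by (simp add: assms inner_conj_mat conj_mat_inverse)

lemma conj_mat_Sym: "A \<in> Sym \<Longrightarrow> conj_mat Q A \<in> Sym"
  by (simp add: Sym_def conj_mat_transpose)

lemma conj_mat_quadratic: "x \<bullet> (conj_mat Q A *v x) = (transpose Q *v x) \<bullet> (A *v (transpose Q *v x))"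
  by (simp add: conj_mat_def matrix_vector_mul_assoc[symmetric] dot_lmul_matrix[symmetric])

lemma orthogonal_matrix_vector_eq_0:
  fixes Q :: mat3
  assumes "orthogonal_matrix Q" "Q *v x = 0"
  shows "x = 0"
  using assms by (metis matrix_vector_mul_assoc matrix_vector_mul_lid matrix_vector_mult_0_right
      orthogonal_matrix_def)

lemma conj_mat_Sym_pp:
  assumes "orthogonal_matrix Q" "A \<in> Sym_pp"
  shows "conj_mat Q A \<in> Sym_pp"
  using assms orthogonal_matrix_vector_eq_0[of "transpose Q"]
  by (auto simp: Sym_pp_def conj_mat_Sym conj_mat_quadratic orthogonal_matrix_transpose)

section \<open>Rotations and their infinitesimal generators\<close>

lemma rotation_transpose: "rotation_matrix Q \<Longrightarrow> rotation_matrix (transpose Q)"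
  by (simp add: rotation_matrix_def orthogonal_matrix_transpose)

lemma rotation_mult: "rotation_matrix P \<Longrightarrow> rotation_matrix Q \<Longrightarrow> rotation_matrix (P ** Q)"
  for P Q :: mat3
  by (simp add: rotation_matrix_def orthogonal_matrix_mul det_mul)

lemma rotation_orthogonal: "rotation_matrix Q \<Longrightarrow> orthogonal_matrix Q"
  by (simp add: rotation_matrix_def)

text \<open>Infinitesimal generator of the rotations in the coordinate plane of \<open>i\<close> and
  \<open>j\<close>; for \<open>i \<noteq> j\<close> these matrices span the skew-symmetric
  ones.\<close>

definition plane_gen :: "3 \<Rightarrow> 3 \<Rightarrow> mat3"
  where "plane_gen i j = (\<chi> a b. if a = i \<and> b = j then -1 else if a = j \<and> b = i then 1 else 0)"

text \<open>For \<open>i \<noteq> j\<close> the cube of the generator is its negative, so this is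
  Rodrigues' formula for the exponential of \<open>t *\<^sub>R plane_gen i j\<close>.\<close>

definition plane_rot :: "3 \<Rightarrow> 3 \<Rightarrow> real \<Rightarrow> mat3"
  where "plane_rot i j t = mat 1 + sin t *\<^sub>R plane_gen i j
    + (1 - cos t) *\<^sub>R (plane_gen i j ** plane_gen i j)"

lemma plane_rot_rotation:
  assumes "i \<noteq> j"
  shows "rotation_matrix (plane_rot i j t)"
proof -
  have sq: "cos t ^ 2 = 1 - sin t ^ 2" by (simp add: cos_squared_eq)
  \<comment> \<open>With the indices quantified, \<open>forall_3\<close> splits the claim into
    finitely many explicit matrices that the simplifier can evaluate.\<close>
  have "\<forall>i j. i \<noteq> j \<longrightarrow> orthogonal_matrix (plane_rot i j t) \<and> det (plane_rot i j t) = 1"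
    unfolding forall_3 orthogonal_matrix plane_rot_def plane_gen_def
    by (simp add: vec_eq_iff forall_3 matrix_matrix_mult_def transpose_def sum_3 det_3 mat_def
        power2_eq_square[symmetric] sq)
  then show ?thesis using assms by (simp add: rotation_matrix_def)
qed

lemma plane_rot_0: "plane_rot i j 0 = mat 1"
  by (simp add: plane_rot_def)

lemma plane_rot_derivative:
  "((plane_rot i j) has_vector_derivative plane_gen i j) (at 0)"
  unfolding plane_rot_def
  by (auto intro!: derivative_eq_intros)

lemma plane_gen_transpose: "transpose (plane_gen i j) = - plane_gen i j" if "i \<noteq> j"
  using that by (auto simp: plane_gen_def transpose_def vec_eq_iff)

lemma plane_rot_conj_derivative:
  assumes "i \<noteq> j"
  shows "((\<lambda>t. conj_mat (plane_rot i j t) A) has_vector_derivative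
    (plane_gen i j ** A - A ** plane_gen i j)) (at 0)"
proof -
  have tr: "((\<lambda>t. transpose (plane_rot i j t)) has_vector_derivative - plane_gen i j) (at 0)"
    using bounded_linear.has_vector_derivative[OF bounded_linear_transpose_mat3 plane_rot_derivative[of i j]]
      plane_gen_transpose[OF assms] by simp
  have *: "((\<lambda>t. plane_rot i j t ** A) has_vector_derivative plane_gen i j ** A) (at 0)"
    using mm_has_vector_derivative[OF plane_rot_derivative has_vector_derivative_const, of i j A]
    by (simp add: mm_simps)
  show ?thesis
    using mm_has_vector_derivative[OF * tr]
    by (simp add: conj_mat_def plane_rot_0 transpose_simps mm_simps)
qed

text \<open>The commutator is the velocity of \<open>A\<close> under the plane rotation, so this
  computes the derivative of the functional maximised in the diagonalization. For symmetric
  \<open>A\<close> and distinct \<open>c $ i\<close>, \<open>c $ j\<close> it vanishes only if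
  \<open>A $ i $ j = 0\<close>.\<close>

lemma plane_gen_commutator_diag:
  assumes "i \<noteq> j"
  shows "(plane_gen i j ** A - A ** plane_gen i j) \<bullet> diag_mat c = (c $ j - c $ i) * (A $ i $ j + A $ j $ i)"
proof -
  have "\<forall>i j. i \<noteq> j \<longrightarrow>
     (plane_gen i j ** A - A ** plane_gen i j) \<bullet> diag_mat c = (c $ j - c $ i) * (A $ i $ j + A $ j $ i)"
    unfolding forall_3
    by (simp add: plane_gen_def diag_mat_def inner_vec_def sum_3 matrix_matrix_mult_def algebra_simps)
  then show ?thesis using assms by simp
qed

text \<open>The set is cut out by polynomial equations, and orthogonality fixes the Frobenius
  norm.\<close>

lemma compact_rotations: "compact {Q :: mat3. rotation_matrix Q}"
proof -
  have cont: "continuous_on UNIV (\<lambda>Q::mat3. transpose Q ** Q)"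
    by (intro bounded_bilinear.continuous_on[OF bounded_bilinear_matrix_mult]
        linear_continuous_on bounded_linear_transpose_mat3 continuous_on_id)
  have contd: "continuous_on UNIV (\<lambda>Q::mat3. det Q)"
    unfolding det_3 by (intro continuous_intros)
  have eq: "{Q :: mat3. rotation_matrix Q} = {Q. transpose Q ** Q = mat 1} \<inter> {Q. det Q = 1}"
    by (auto simp: rotation_matrix_def orthogonal_matrix)
  have "closed {Q :: mat3. rotation_matrix Q}"
    unfolding eq by (intro closed_Int closed_Collect_eq cont contd continuous_on_const)
  moreover have "norm Q ^ 2 = trace (mat 1 :: mat3)" if "rotation_matrix Q" for Q :: mat3
    using that unfolding power2_norm_eq_inner inner_eq_trace
    by (simp add: rotation_matrix_def orthogonal_matrix_def)
  then have "bounded {Q :: mat3. rotation_matrix Q}"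
    unfolding bounded_iff by (metis mem_Collect_eq real_le_rsqrt order_refl)
  ultimately show ?thesis by (simp add: compact_eq_bounded_closed)
qed

text \<open>At a rotation maximising \<open>Q \<mapsto> \<langle>Q\<^sup>T S Q, C\<rangle>\<close>, for a diagonal \<open>C\<close> with distinct entries,
  the derivatives along plane rotations vanish, and these are multiples of the off-diagonal
  entries of \<open>Q\<^sup>T S Q\<close>.\<close>

lemma symmetric_diagonalization:
  assumes "S \<in> Sym"
  obtains Q s where "rotation_matrix Q" "S = conj_mat Q (diag_mat s)"
proof -
  define c :: "real^3" where "c = vector [1, 2, 3]"
  let ?f = "\<lambda>Q. conj_mat Q S \<bullet> diag_mat c"
  have cont: "continuous_on {Q. rotation_matrix Q} ?f"
    unfolding conj_mat_def
    by (intro continuous_intros bounded_bilinear.continuous_on[OF bounded_bilinear_matrix_mult]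
        linear_continuous_on bounded_linear_transpose_mat3)
  have ne: "{Q::mat3. rotation_matrix Q} \<noteq> {}"
    using plane_rot_rotation[of 1 2] by force
  \<comment> \<open>\<open>P\<close> conjugates \<open>S\<close> into diagonal form, so its
    transpose is the rotation in the conclusion. Maximising over rotations keeps the eigenbasis
    within the group to which isotropy applies.\<close>
  obtain P where P: "rotation_matrix P" and max: "\<And>Q. rotation_matrix Q \<Longrightarrow> ?f Q \<le> ?f P"
    using continuous_attains_sup[OF compact_rotations ne cont] by auto
  define A where "A = conj_mat P S"
  have A: "A \<in> Sym" unfolding A_def by (rule conj_mat_Sym[OF assms])
  have off: "A $ i $ j = 0" if ij: "i \<noteq> j" for i j
  proof -
    let ?g = "\<lambda>t. conj_mat (plane_rot i j t) A \<bullet> diag_mat c"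
    have "((\<lambda>t. conj_mat (plane_rot i j t) A) has_vector_derivative
       (plane_gen i j ** A - A ** plane_gen i j)) (at 0)"
      by (rule plane_rot_conj_derivative[OF ij])
    from bounded_linear.has_vector_derivative[OF bounded_linear_inner_left[of "diag_mat c"] this]
    have "(?g has_vector_derivative (c $ j - c $ i) * (A $ i $ j + A $ j $ i)) (at 0)"
      unfolding plane_gen_commutator_diag[OF ij] .
    then have "DERIV ?g 0 :> (c $ j - c $ i) * (A $ i $ j + A $ j $ i)"
      by (simp add: has_real_derivative_iff_has_vector_derivative)
    moreover have "?g t \<le> ?g 0" for t
      using max[OF rotation_mult[OF plane_rot_rotation[OF ij] P]]
      by (simp add: A_def conj_mat_conj_mat plane_rot_0)
    ultimately have z: "(c $ j - c $ i) * (A $ i $ j + A $ j $ i) = 0"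
      by (intro DERIV_local_max[of ?g _ 0 1]) auto
    have "\<forall>i j. i \<noteq> j \<longrightarrow> c $ j - c $ i \<noteq> 0"
      unfolding forall_3 c_def by simp
    moreover have "A $ j $ i = A $ i $ j"
      using A unfolding Sym_def by (metis (mono_tags) mem_Collect_eq transpose_def vec_lambda_beta)
    ultimately show ?thesis using z ij by auto
  qed
  have "A = diag_mat (\<chi> i. A $ i $ i)"
    using off by (auto simp: diag_mat_def vec_eq_iff)
  then have "S = conj_mat (transpose P) (diag_mat (\<chi> i. A $ i $ i))"
    using conj_mat_inverse(1)[OF rotation_orthogonal[OF P], of S] unfolding A_def by simp
  then show ?thesis using that rotation_transpose[OF P] by blast
qed

subsection \<open>Exponential, logarithm and square root in an eigenbasis\<close>

lemma diag_mat_mult_diag_mat: "diag_mat a ** diag_mat b = diag_mat (\<chi> i. a $ i * b $ i)"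
  by (simp add: diag_mat_def matrix_matrix_mult_def vec_eq_iff forall_3 sum_3)

lemma diag_mat_mult_nth: "(diag_mat a ** R) $ i $ j = a $ i * R $ i $ j"
  and mult_diag_mat_nth: "(R ** diag_mat b) $ i $ j = R $ i $ j * b $ j"
proof -
  have "\<forall>i j. (diag_mat a ** R) $ i $ j = a $ i * R $ i $ j"
    "\<forall>i j. (R ** diag_mat b) $ i $ j = R $ i $ j * b $ j"
    unfolding forall_3 by (simp_all add: diag_mat_def matrix_matrix_mult_def sum_3)
  then show "(diag_mat a ** R) $ i $ j = a $ i * R $ i $ j"
    "(R ** diag_mat b) $ i $ j = R $ i $ j * b $ j" by auto
qed

lemma diag_mat_Sym: "diag_mat d \<in> Sym"
  by (auto simp: Sym_def diag_mat_def transpose_def vec_eq_iff)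

lemma diag_mat_one: "diag_mat (\<chi> i. 1) = mat 1"
  by (simp add: diag_mat_def mat_def vec_eq_iff)

text \<open>For diagonal \<open>X\<close> and \<open>Y\<close> the intertwining relation can be read
  off entry by entry, which compares two spectral decompositions without a common
  eigenbasis.\<close>

lemma conj_mat_eq_iff:
  assumes Q: "orthogonal_matrix Q" and P: "orthogonal_matrix P"
  shows "conj_mat Q X = conj_mat P Y \<longleftrightarrow> X ** (transpose Q ** P) = (transpose Q ** P) ** Y"
proof
  have QQ: "transpose Q ** Q = mat 1" and PP: "transpose P ** P = mat 1"
    and QQ': "Q ** transpose Q = mat 1" and PP': "P ** transpose P = mat 1"
    using Q P by (simp_all add: orthogonal_matrix_def)
  show "X ** (transpose Q ** P) = (transpose Q ** P) ** Y" if eq: "conj_mat Q X = conj_mat P Y"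
  proof -
    have "transpose Q ** conj_mat Q X ** P = (transpose Q ** Q) ** X ** (transpose Q ** P)"
      unfolding conj_mat_def by (simp only: matrix_mul_assoc)
    moreover have "transpose Q ** conj_mat P Y ** P = transpose Q ** P ** Y ** (transpose P ** P)"
      unfolding conj_mat_def by (simp only: matrix_mul_assoc)
    ultimately show ?thesis using eq by (simp add: QQ PP)
  qed
  show "conj_mat Q X = conj_mat P Y" if eq: "X ** (transpose Q ** P) = (transpose Q ** P) ** Y"
  proof -
    have "conj_mat Q X = Q ** X ** transpose Q ** (P ** transpose P)"
      by (simp add: PP' conj_mat_def)
    also have "\<dots> = Q ** (X ** (transpose Q ** P)) ** transpose P"
      by (simp only: matrix_mul_assoc)
    also have "\<dots> = (Q ** transpose Q) ** P ** Y ** transpose P"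
      unfolding eq by (simp only: matrix_mul_assoc)
    also have "\<dots> = conj_mat P Y"
      by (simp add: QQ' conj_mat_def)
    finally show ?thesis .
  qed
qed

text \<open>With \<open>R = transpose Q ** P\<close>, equality says
  \<open>f (a $ i) * R $ i $ j = R $ i $ j * f (b $ j)\<close>: either the entry of \<open>R\<close>
  is 0 or the eigenvalues agree. Injectivity is asked only at the eigenvalues, so the lemma covers
  squaring on positive numbers as well as \<open>exp\<close>.\<close>

lemma functional_calculus_injective:
  assumes Q: "orthogonal_matrix Q" and P: "orthogonal_matrix P"
    and eq: "conj_mat Q (diag_mat (\<chi> i. f (a $ i))) = conj_mat P (diag_mat (\<chi> i. f (b $ i)))"
    and inj: "\<And>i j. f (a $ i) = f (b $ j) \<Longrightarrow> a $ i = b $ j"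
  shows "conj_mat Q (diag_mat a) = conj_mat P (diag_mat b)"
proof -
  let ?R = "transpose Q ** P"
  have *: "f (a $ i) * ?R $ i $ j = ?R $ i $ j * f (b $ j)" for i j
    using arg_cong[OF eq[unfolded conj_mat_eq_iff[OF Q P]], of "\<lambda>M. M $ i $ j"]
    unfolding diag_mat_mult_nth mult_diag_mat_nth by simp
  have "a $ i * ?R $ i $ j = ?R $ i $ j * b $ j" for i j
    using *[of i j] inj[of i j] by (cases "?R $ i $ j = 0") auto
  then show ?thesis
    unfolding conj_mat_eq_iff[OF Q P] unfolding vec_eq_iff diag_mat_mult_nth mult_diag_mat_nth by simp
qed

lemma diag_mat_quadratic: "x \<bullet> (diag_mat d *v x) = (\<Sum>i\<in>UNIV. d $ i * (x $ i)\<^sup>2)"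
  by (simp add: diag_mat_def matrix_vector_mult_def inner_vec_def sum_3 power2_eq_square)

lemma diag_mat_Sym_pp: "diag_mat d \<in> Sym_pp \<longleftrightarrow> (\<forall>i. d $ i > 0)"
proof
  assume d: "diag_mat d \<in> Sym_pp"
  show "\<forall>i. d $ i > 0"
  proof
    fix i
    have "(axis i 1 :: real^3) \<noteq> 0" by (simp add: axis_eq_0_iff)
    then have "(axis i 1 :: real^3) \<bullet> (diag_mat d *v axis i 1) > 0"
      using d by (auto simp: Sym_pp_def)
    moreover have "\<forall>i. (\<Sum>j\<in>UNIV. d $ j * ((axis i 1 :: real^3) $ j)\<^sup>2) = d $ i"
      unfolding forall_3 by (simp add: axis_def sum_3)
    ultimately show "d $ i > 0" by (simp add: diag_mat_quadratic)
  qed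
next
  assume d: "\<forall>i. d $ i > 0"
  have "(\<Sum>i\<in>UNIV. d $ i * (x $ i)\<^sup>2) > 0" if nz: "x \<noteq> 0" for x :: "real^3"
  proof -
    obtain i where "x $ i \<noteq> 0" using nz by (auto simp: vec_eq_iff)
    then show ?thesis using d by (intro sum_pos2[of _ i]) (auto simp: less_imp_le)
  qed
  then show "diag_mat d \<in> Sym_pp"
    by (simp add: Sym_pp_def diag_mat_Sym diag_mat_quadratic)
qed

lemma conj_mat_Sym_pp_iff:
  assumes "orthogonal_matrix Q"
  shows "conj_mat Q A \<in> Sym_pp \<longleftrightarrow> A \<in> Sym_pp"
  using assms conj_mat_Sym_pp[OF assms] conj_mat_Sym_pp[of "transpose Q" "conj_mat Q A"]
  by (auto simp: orthogonal_matrix_transpose conj_mat_inverse)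

lemma Sym_pp_diagonalization:
  assumes "V \<in> Sym_pp"
  obtains Q v where "rotation_matrix Q" "V = conj_mat Q (diag_mat v)" "\<And>i. v $ i > 0"
proof -
  have "V \<in> Sym" using assms by (simp add: Sym_pp_def)
  from symmetric_diagonalization[OF this] obtain Q v where
    *: "rotation_matrix Q" "V = conj_mat Q (diag_mat v)" by blast
  with assms have "\<And>i. v $ i > 0"
    using conj_mat_Sym_pp_iff[OF rotation_orthogonal] diag_mat_Sym_pp by blast
  with * show ?thesis using that by blast
qed

section \<open>Exponential series, logarithm, square root and left stretch\<close>

lemma mat_pow_0: "mat_pow A 0 = mat 1"
  and mat_pow_Suc: "mat_pow A (Suc k) = A ** mat_pow A k"
  by (simp_all add: mat_pow_def)

lemma mat_pow_conj_mat:
  "orthogonal_matrix Q \<Longrightarrow> mat_pow (conj_mat Q A) k = conj_mat Q (mat_pow A k)"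
  by (induction k) (simp_all add: mat_pow_0 mat_pow_Suc conj_mat_mult conj_mat_one)

lemma mat_pow_diag_mat: "mat_pow (diag_mat d) k = diag_mat (\<chi> i. d $ i ^ k)"
  by (induction k) (simp_all add: mat_pow_0 mat_pow_Suc diag_mat_one diag_mat_mult_diag_mat)

lemma sums_vecI:
  fixes f :: "nat \<Rightarrow> 'a::real_normed_vector ^ 'n"
  assumes "\<And>i. (\<lambda>k. f k $ i) sums (x $ i)"
  shows "f sums x"
  using assms unfolding sums_def by (intro vec_tendstoI) simp

lemma exp_term_sums: "(\<lambda>k. (1 / fact k) * x ^ k) sums exp x" for x :: real
  using exp_converges[of x] by (simp add: field_simps)

lemma mat_exp_conj_diag:
  assumes "orthogonal_matrix Q"
  shows "mat_exp (conj_mat Q (diag_mat d)) = conj_mat Q (diag_mat (\<chi> i. exp (d $ i)))"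
proof -
  have "(\<lambda>k. (1 / fact k) *\<^sub>R diag_mat (\<chi> i. d $ i ^ k)) sums diag_mat (\<chi> i. exp (d $ i))"
    by (intro sums_vecI) (auto simp: diag_mat_def exp_term_sums[simplified])
  from bounded_linear.sums[OF bounded_linear_conj_mat this, of Q]
  have "(\<lambda>k. (1 / fact k) *\<^sub>R mat_pow (conj_mat Q (diag_mat d)) k) sums
    conj_mat Q (diag_mat (\<chi> i. exp (d $ i)))"
    by (simp add: conj_mat_simps mat_pow_conj_mat[OF assms] mat_pow_diag_mat)
  then show ?thesis unfolding mat_exp_def by (rule sums_unique[symmetric])
qed

lemma mat_exp_Sym_pp: "S \<in> Sym \<Longrightarrow> mat_exp S \<in> Sym_pp"
  by (elim symmetric_diagonalization)
    (simp add: mat_exp_conj_diag rotation_orthogonal conj_mat_Sym_pp_iff diag_mat_Sym_pp)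

lemma mat_exp_inj:
  assumes "S \<in> Sym" "T \<in> Sym" "mat_exp S = mat_exp T"
  shows "S = T"
proof -
  obtain Q s P t where *: "rotation_matrix Q" "S = conj_mat Q (diag_mat s)"
    "rotation_matrix P" "T = conj_mat P (diag_mat t)"
    using symmetric_diagonalization assms(1,2) by metis
  show ?thesis
    unfolding *(2,4)
    by (rule functional_calculus_injective[where f = exp])
      (use * assms(3) in \<open>auto simp: mat_exp_conj_diag rotation_orthogonal\<close>)
qed

lemma mat_exp_surj:
  assumes "V \<in> Sym_pp"
  obtains S where "S \<in> Sym" "mat_exp S = V"
proof -
  obtain Q v where *: "rotation_matrix Q" "V = conj_mat Q (diag_mat v)" "\<And>i. v $ i > 0"
    using Sym_pp_diagonalization[OF assms] by metis
  show ?thesis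
  proof (rule that[of "conj_mat Q (diag_mat (\<chi> i. ln (v $ i)))"])
    show "mat_exp (conj_mat Q (diag_mat (\<chi> i. ln (v $ i)))) = V"
      using * by (simp add: mat_exp_conj_diag rotation_orthogonal)
  qed (simp add: conj_mat_Sym diag_mat_Sym)
qed

lemma mat_log_mat_exp: "S \<in> Sym \<Longrightarrow> mat_log (mat_exp S) = S"
  unfolding mat_log_def by (rule the_equality) (auto intro: mat_exp_inj)

lemma mat_log_Sym: "V \<in> Sym_pp \<Longrightarrow> mat_log V \<in> Sym"
  and mat_exp_mat_log: "V \<in> Sym_pp \<Longrightarrow> mat_exp (mat_log V) = V"
  by (metis mat_exp_surj mat_log_mat_exp)+

lemma mat_exp_image: "mat_exp ` Sym = Sym_pp"
  using mat_exp_Sym_pp mat_exp_surj by blast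

lemma mat_square_conj_diag:
  assumes "orthogonal_matrix Q"
  shows "conj_mat Q (diag_mat d) ** conj_mat Q (diag_mat d) = conj_mat Q (diag_mat (\<chi> i. (d $ i)\<^sup>2))"
  by (simp add: conj_mat_mult[OF assms, symmetric] diag_mat_mult_diag_mat power2_eq_square)

lemma mat_square_inj:
  assumes "U \<in> Sym_pp" "V \<in> Sym_pp" "U ** U = V ** V"
  shows "U = V"
proof -
  obtain Q u P v where *: "rotation_matrix Q" "U = conj_mat Q (diag_mat u)" "\<And>i. u $ i > 0"
    "rotation_matrix P" "V = conj_mat P (diag_mat v)" "\<And>i. v $ i > 0"
    using Sym_pp_diagonalization assms(1,2) by metis
  show ?thesis
    unfolding *(2,5)
    by (rule functional_calculus_injective[where f = "\<lambda>x. x\<^sup>2"])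
      (use * assms(3) in \<open>auto simp: mat_square_conj_diag rotation_orthogonal less_imp_le power2_eq_iff_nonneg\<close>)
qed

lemma mat_sqrt_square:
  assumes "V \<in> Sym_pp"
  shows "mat_sqrt (V ** V) = V"
  unfolding mat_sqrt_def by (rule the_equality) (auto intro: mat_square_inj assms)

lemma
  assumes "B \<in> Sym_pp"
  shows mat_sqrt_Sym_pp: "mat_sqrt B \<in> Sym_pp"
    and square_mat_sqrt: "mat_sqrt B ** mat_sqrt B = B"
proof -
  obtain Q v where *: "rotation_matrix Q" "B = conj_mat Q (diag_mat v)" "\<And>i. v $ i > 0"
    using Sym_pp_diagonalization[OF assms] by metis
  define V where "V = conj_mat Q (diag_mat (\<chi> i. sqrt (v $ i)))"
  have "V \<in> Sym_pp" "V ** V = B"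
    using * by (auto simp: V_def conj_mat_Sym_pp_iff rotation_orthogonal diag_mat_Sym_pp
        mat_square_conj_diag less_imp_le)
  then show "mat_sqrt B \<in> Sym_pp" "mat_sqrt B ** mat_sqrt B = B"
    using mat_sqrt_square by auto
qed

lemma mult_transpose_Sym_pp:
  assumes "F \<in> GL_plus"
  shows "F ** transpose F \<in> Sym_pp"
proof -
  have "invertible (transpose F)" using assms by (simp add: GL_plus_def invertible_det_nz)
  then have "transpose F *v x \<noteq> 0" if "x \<noteq> 0" for x
    using that by (metis inj_eq inj_matrix_vector_mult matrix_vector_mult_0_right)
  moreover have "x \<bullet> ((F ** transpose F) *v x) = (transpose F *v x) \<bullet> (transpose F *v x)" for x
    by (simp add: matrix_vector_mul_assoc[symmetric] dot_lmul_matrix[symmetric])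
  ultimately show ?thesis by (auto simp: Sym_pp_def Sym_def transpose_simps)
qed

lemma
  assumes "F \<in> GL_plus"
  shows left_stretch_Sym_pp: "left_stretch F \<in> Sym_pp"
    and square_left_stretch: "left_stretch F ** left_stretch F = F ** transpose F"
  unfolding left_stretch_def
  using mat_sqrt_Sym_pp square_mat_sqrt mult_transpose_Sym_pp[OF assms] by auto

subsection \<open>The derivative of the matrix exponential\<close>

text \<open>Derivative of the \<open>k\<close>-th power at \<open>A\<close> in direction
  \<open>H\<close>, unfolded by the product rule from the left.\<close>

primrec mat_pow_deriv :: "mat3 \<Rightarrow> mat3 \<Rightarrow> nat \<Rightarrow> mat3" where
  "mat_pow_deriv A H 0 = 0"
| "mat_pow_deriv A H (Suc k) = H ** mat_pow A k + A ** mat_pow_deriv A H k"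

text \<open>Three inductions with \<open>r = K * \<rho>\<close>: powers grow with base
  \<open>r\<close>, first differences with base \<open>2 * r\<close>, Taylor remainders with base
  \<open>4 * r\<close>. Enlarging the base absorbs the two summands of the product rule. Since
  \<open>\<rho> \<ge> 1\<close> gives \<open>K \<le> r\<close>, multiplication by \<open>H\<close>
  costs at most \<open>r * norm H\<close>.\<close>

lemma mat_pow_taylor_bound:
  assumes K: "\<And>(a::mat3) (b::mat3). norm (a ** b) \<le> norm a * norm b * K" "K > 0"
    and \<rho>: "norm A \<le> \<rho>" "norm (A + H) \<le> \<rho>" "\<rho> \<ge> 1"
  defines "c \<equiv> norm (mat 1 :: mat3)"
  shows "norm (mat_pow A k) \<le> c * (K * \<rho>) ^ k"
    and "norm (mat_pow (A + H) k - mat_pow A k - mat_pow_deriv A H k) \<le> c * (4 * (K * \<rho>)) ^ k * (norm H)\<^sup>2"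
proof -
  define r where "r = K * \<rho>"
  have r: "r \<ge> K" "r > 0" using K(2) \<rho>(3) by (auto simp: r_def)
  have c: "c \<ge> 0" by (simp add: c_def)
  have bd: "norm (X ** Y) \<le> r * y" if "norm X \<le> \<rho>" "norm Y \<le> y" for X Y :: mat3 and y
  proof -
    have "norm (X ** Y) \<le> norm X * norm Y * K" by (rule K)
    also have "\<dots> \<le> \<rho> * y * K"
      using that K(2) \<rho>(3) order_trans[OF norm_ge_zero that(2)] by (intro mult_mono) auto
    finally show ?thesis by (simp add: r_def mult_ac)
  qed
  have bH: "norm (H ** Y) \<le> r * (norm H * y)" if "norm Y \<le> y" for Y :: mat3 and y
  proof -
    have "norm (H ** Y) \<le> norm H * norm Y * K" by (rule K)
    also have "\<dots> \<le> norm H * y * r"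
      using that K(2) r order_trans[OF norm_ge_zero that] by (intro mult_mono) auto
    finally show ?thesis by (simp add: mult_ac)
  qed
  have pow: "norm (mat_pow X k) \<le> c * r ^ k" if "norm X \<le> \<rho>" for X k
  proof (induction k)
    case (Suc k)
    then show ?case using bd[OF that Suc] by (simp add: mat_pow_Suc mult_ac)
  qed (simp add: mat_pow_0 c_def)
  have diff: "norm (mat_pow (A + H) k - mat_pow A k) \<le> c * (2 * r) ^ k * norm H" for k
  proof (induction k)
    case (Suc k)
    have eq: "mat_pow (A + H) (Suc k) - mat_pow A (Suc k)
      = A ** (mat_pow (A + H) k - mat_pow A k) + H ** mat_pow (A + H) k"
      by (simp add: mat_pow_Suc mm_simps)
    have "norm (mat_pow (A + H) (Suc k) - mat_pow A (Suc k))
      \<le> r * (c * (2 * r) ^ k * norm H) + r * (norm H * (c * r ^ k))"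
      unfolding eq by (rule order_trans[OF norm_triangle_ineq add_mono[OF bd[OF \<rho>(1) Suc] bH[OF pow[OF \<rho>(2)]]]])
    also have "r * (norm H * (c * r ^ k)) \<le> r * (norm H * (c * (2 * r) ^ k))"
      using r c by (intro mult_left_mono power_mono) auto
    finally show ?case by (simp add: algebra_simps)
  qed (simp add: mat_pow_0 c_def)
  show "norm (mat_pow A k) \<le> c * (K * \<rho>) ^ k"
    using pow[OF \<rho>(1)] by (simp add: r_def)
  have "norm (mat_pow (A + H) k - mat_pow A k - mat_pow_deriv A H k) \<le> c * (4 * r) ^ k * (norm H)\<^sup>2" for k
  proof (induction k)
    case (Suc k)
    have eq: "mat_pow (A + H) (Suc k) - mat_pow A (Suc k) - mat_pow_deriv A H (Suc k)
      = A ** (mat_pow (A + H) k - mat_pow A k - mat_pow_deriv A H k) + H ** (mat_pow (A + H) k - mat_pow A k)"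
      by (simp add: mat_pow_Suc mm_simps)
    have "norm (mat_pow (A + H) (Suc k) - mat_pow A (Suc k) - mat_pow_deriv A H (Suc k))
      \<le> r * (c * (4 * r) ^ k * (norm H)\<^sup>2) + r * (norm H * (c * (2 * r) ^ k * norm H))"
      unfolding eq by (rule order_trans[OF norm_triangle_ineq add_mono[OF bd[OF \<rho>(1) Suc] bH[OF diff]]])
    also have "r * (norm H * (c * (2 * r) ^ k * norm H)) \<le> r * (norm H * (c * (4 * r) ^ k * norm H))"
      using r c by (intro mult_left_mono mult_right_mono power_mono) auto
    finally have "norm (mat_pow (A + H) (Suc k) - mat_pow A (Suc k) - mat_pow_deriv A H (Suc k))
      \<le> 2 * (r * (c * (4 * r) ^ k * (norm H)\<^sup>2))"
      by (simp add: power2_eq_square mult_ac)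
    also have "\<dots> \<le> 4 * (r * (c * (4 * r) ^ k * (norm H)\<^sup>2))"
      using r c by (intro mult_right_mono) auto
    finally show ?case by (simp add: mult_ac)
  qed (simp add: mat_pow_0 c_def)
  then show "norm (mat_pow (A + H) k - mat_pow A k - mat_pow_deriv A H k) \<le> c * (4 * (K * \<rho>)) ^ k * (norm H)\<^sup>2"
    by (simp add: r_def)
qed

lemma mat_exp_sums: "(\<lambda>k. (1 / fact k) *\<^sub>R mat_pow A k) sums mat_exp A"
proof -
  obtain K where K: "K > 0" "\<And>(a::mat3) (b::mat3). norm (a ** b) \<le> norm a * norm b * K"
    using bounded_bilinear.pos_bounded[OF bounded_bilinear_matrix_mult] by blast
  let ?c = "norm (mat 1 :: mat3)" and ?\<rho> = "norm A + 1"
  have "summable (\<lambda>k. (1 / fact k) *\<^sub>R mat_pow A k)"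
  proof (rule summable_comparison_test)
    show "summable (\<lambda>k. ?c * ((1 / fact k) * (K * ?\<rho>) ^ k))"
      using exp_term_sums by (intro summable_mult) (rule sums_summable)
    show "\<exists>N. \<forall>n\<ge>N. norm ((1 / fact n) *\<^sub>R mat_pow A n) \<le> ?c * ((1 / fact n) * (K * ?\<rho>) ^ n)"
      using mat_pow_taylor_bound(1)[OF K(2,1), of A ?\<rho> 0]
      by (auto simp: divide_right_mono)
  qed
  then show ?thesis unfolding mat_exp_def by (rule summable_sums)
qed

lemma has_derivative_quadratic_remainder:
  assumes "bounded_linear E" "C > 0"
    and le: "\<And>H. norm H \<le> 1 \<Longrightarrow> norm (f (x + H) - f x - E H) \<le> C * (norm H)\<^sup>2"
  shows "(f has_derivative E) (at x)"
  unfolding has_derivative_at_alt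
proof (intro conjI allI impI)
  fix e :: real assume e: "e > 0"
  show "\<exists>d>0. \<forall>y. norm (y - x) < d \<longrightarrow> norm (f y - f x - E (y - x)) \<le> e * norm (y - x)"
  proof (intro exI[of _ "min 1 (e / C)"] conjI allI impI)
    fix y assume y: "norm (y - x) < min 1 (e / C)"
    then have "norm (f y - f x - E (y - x)) \<le> C * norm (y - x) * norm (y - x)"
      using le[of "y - x"] by (simp add: power2_eq_square mult.assoc)
    also have "\<dots> \<le> e * norm (y - x)"
      using y assms(2) by (intro mult_right_mono) (auto simp: field_simps)
    finally show "norm (f y - f x - E (y - x)) \<le> e * norm (y - x)" .
  qed (use e assms(2) in auto)
qed (rule assms(1))

text \<open>Summing the remainder bounds with weights \<open>1 / fact k\<close> gives a quadratic
  remainder with constant \<open>c * exp (4 * (K * \<rho>))\<close>; the radius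
  \<open>\<rho> = norm A + 1\<close> covers all \<open>H\<close> of norm at most 1.\<close>

lemma mat_exp_has_derivative:
  assumes E: "bounded_linear E"
    and sums: "\<And>H. (\<lambda>k. (1 / fact k) *\<^sub>R mat_pow_deriv A H k) sums E H"
  shows "(mat_exp has_derivative E) (at A)"
proof -
  obtain K where K: "K > 0" "\<And>(a::mat3) (b::mat3). norm (a ** b) \<le> norm a * norm b * K"
    using bounded_bilinear.pos_bounded[OF bounded_bilinear_matrix_mult] by blast
  define \<rho> c where "\<rho> = norm A + 1" and "c = norm (mat 1 :: mat3)"
  have "c > 0" by (simp add: c_def mat_def vec_eq_iff)
  show ?thesis
  proof (rule has_derivative_quadratic_remainder[OF E])
    show "c * exp (4 * (K * \<rho>)) > 0" using \<open>c > 0\<close> by simp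
    fix H :: mat3 assume "norm H \<le> 1"
    then have \<rho>: "norm A \<le> \<rho>" "norm (A + H) \<le> \<rho>" "\<rho> \<ge> 1"
      using norm_triangle_ineq[of A H] by (auto simp: \<rho>_def)
    let ?R = "\<lambda>k. (1 / fact k) *\<^sub>R (mat_pow (A + H) k - mat_pow A k - mat_pow_deriv A H k)"
    let ?b = "\<lambda>k. (c * (norm H)\<^sup>2) * ((1 / fact k) * (4 * (K * \<rho>)) ^ k)"
    have R: "?R sums (mat_exp (A + H) - mat_exp A - E H)"
      using sums_diff[OF sums_diff[OF mat_exp_sums mat_exp_sums] sums] by (simp add: algebra_simps)
    have b: "?b sums ((c * (norm H)\<^sup>2) * exp (4 * (K * \<rho>)))"
      by (intro sums_mult exp_term_sums)
    have le: "norm (?R k) \<le> ?b k" for k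
      using mult_left_mono[OF mat_pow_taylor_bound(2)[OF K(2,1) \<rho>, of k], of "1 / fact k"]
      by (simp add: c_def mult_ac)
    have "norm (suminf ?R) \<le> suminf ?b"
      by (rule norm_suminf_le[OF le sums_summable[OF b]])
    then show "norm (mat_exp (A + H) - mat_exp A - E H) \<le> c * exp (4 * (K * \<rho>)) * (norm H)\<^sup>2"
      using sums_unique[OF R] sums_unique[OF b] by (simp add: mult_ac)
  qed
qed

text \<open>Divided difference of the \<open>k\<close>-th power at \<open>a\<close> and
  \<open>b\<close>. The recursion avoids division, so it also covers \<open>a = b\<close>, where it
  gives the derivative.\<close>

primrec pow_dd :: "real \<Rightarrow> real \<Rightarrow> nat \<Rightarrow> real" where
  "pow_dd a b 0 = 0"
| "pow_dd a b (Suc k) = b ^ k + a * pow_dd a b k"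

text \<open>First divided difference of \<open>exp\<close>, completed by the derivative on the
  diagonal.\<close>

definition exp_dd :: "real \<Rightarrow> real \<Rightarrow> real"
  where "exp_dd a b = (if a = b then exp a else (exp a - exp b) / (a - b))"

lemma exp_dd_refl: "exp_dd a a = exp a"
  and exp_dd_commute: "exp_dd a b = exp_dd b a"
  by (auto simp: exp_dd_def divide_simps) (auto simp: algebra_simps)

lemma exp_dd_pos: "exp_dd a b > 0"
  by (cases a b rule: linorder_cases) (auto simp: exp_dd_def zero_less_divide_iff)

lemma pow_dd_mult: "pow_dd a b k * (a - b) = a ^ k - b ^ k"
proof (induction k)
  case (Suc k)
  have "pow_dd a b (Suc k) * (a - b) = b ^ k * (a - b) + a * (pow_dd a b k * (a - b))"
    by (simp add: algebra_simps)
  then show ?case unfolding Suc by (simp add: algebra_simps)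
qed simp

lemma pow_dd_refl: "pow_dd a a (Suc k) = real (Suc k) * a ^ k"
  by (induction k) (auto simp: algebra_simps)

lemma pow_dd_sums: "(\<lambda>k. (1 / fact k) * pow_dd a b k) sums exp_dd a b"
proof (cases "a = b")
  case True
  \<comment> \<open>The term with index 0 vanishes, so the shifted series is summed first; its terms
    are those of the exponential series.\<close>
  have "(\<lambda>k. (1 / fact (Suc k)) * pow_dd a a (Suc k)) sums exp a"
  proof -
    have "(1 / fact (Suc k)) * pow_dd a a (Suc k) = (1 / fact k) * a ^ k" for k
      unfolding pow_dd_refl fact_Suc by (simp add: field_simps del: of_nat_Suc)
    then show ?thesis using exp_term_sums[of a] by simp
  qed
  from sums_Suc[OF this] show ?thesis using True by (simp add: exp_dd_def)
next
  case False
  have "(1 / fact k) * pow_dd a b k = ((1 / fact k) * a ^ k - (1 / fact k) * b ^ k) / (a - b)" for k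
  proof -
    have "pow_dd a b k = (a ^ k - b ^ k) / (a - b)"
      using False by (simp add: pow_dd_mult[symmetric])
    then show ?thesis by (simp add: diff_divide_distrib mult.commute)
  qed
  then show ?thesis
    using sums_divide[OF sums_diff[OF exp_term_sums[of a] exp_term_sums[of b]], of "a - b"] False
    by (simp add: exp_dd_def)
qed

text \<open>Schur multiplier: the entrywise form, in an eigenbasis with eigenvalues
  \<open>s\<close>, of linear maps built from left and right multiplication by functions of a
  symmetric matrix.\<close>

definition spectral_mult :: "(real \<Rightarrow> real \<Rightarrow> real) \<Rightarrow> real^3 \<Rightarrow> mat3 \<Rightarrow> mat3"
  where "spectral_mult m s H = (\<chi> i j. m (s $ i) (s $ j) * H $ i $ j)"

lemma linear_spectral_mult: "linear (spectral_mult m s)"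
  by (auto intro!: linearI simp: spectral_mult_def vec_eq_iff algebra_simps)

lemma spectral_mult_Sym:
  assumes "\<And>a b. m a b = m b a" "H \<in> Sym"
  shows "spectral_mult m s H \<in> Sym"
  using assms by (simp add: Sym_def transpose_def vec_eq_iff spectral_mult_def)

lemma mat_pow_deriv_conj_mat:
  assumes "orthogonal_matrix Q"
  shows "mat_pow_deriv (conj_mat Q A) (conj_mat Q H) k = conj_mat Q (mat_pow_deriv A H k)"
  by (induction k) (simp_all add: conj_mat_simps mat_pow_conj_mat[OF assms] conj_mat_mult[OF assms])

lemma mat_pow_deriv_diag_mat: "mat_pow_deriv (diag_mat s) H k = spectral_mult (\<lambda>a b. pow_dd a b k) s H"
  by (induction k) (simp_all add: vec_eq_iff spectral_mult_def mat_pow_diag_mat mult_diag_mat_nth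
      diag_mat_mult_nth algebra_simps)

text \<open>The Daleckii-Krein formula. In an eigenbasis \<open>mat_pow_deriv\<close> multiplies
  entries by the divided differences of the powers, and these sum to those of \<open>exp\<close>;
  repeated eigenvalues are included.\<close>

lemma mat_exp_has_derivative_spectral:
  assumes Q: "orthogonal_matrix Q"
  shows "(mat_exp has_derivative (\<lambda>H. conj_mat Q (spectral_mult exp_dd s (conj_mat (transpose Q) H))))
    (at (conj_mat Q (diag_mat s)))"
proof (rule mat_exp_has_derivative)
  have "linear (conj_mat Q \<circ> (spectral_mult exp_dd s \<circ> conj_mat (transpose Q)))"
    by (intro linear_compose linear_conj_mat linear_spectral_mult)
  then show "bounded_linear (\<lambda>H. conj_mat Q (spectral_mult exp_dd s (conj_mat (transpose Q) H)))"
    by (simp add: linear_conv_bounded_linear o_def)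
  fix H
  let ?H = "conj_mat (transpose Q) H"
  have "(\<lambda>k. (1 / fact k) *\<^sub>R spectral_mult (\<lambda>a b. pow_dd a b k) s ?H) sums spectral_mult exp_dd s ?H"
    by (intro sums_vecI) (use sums_mult2[OF pow_dd_sums] in \<open>auto simp: spectral_mult_def\<close>)
  from bounded_linear.sums[OF bounded_linear_conj_mat this, of Q]
  show "(\<lambda>k. (1 / fact k) *\<^sub>R mat_pow_deriv (conj_mat Q (diag_mat s)) H k)
    sums conj_mat Q (spectral_mult exp_dd s ?H)"
    using mat_pow_deriv_conj_mat[OF Q, of "diag_mat s" ?H]
    by (simp add: conj_mat_simps mat_pow_deriv_diag_mat conj_mat_inverse[OF Q])
qed

subsection \<open>Calculus on the positive definite matrices\<close>

lemma Sym_pp_subset_Sym: "Sym_pp \<subseteq> Sym"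
  by (auto simp: Sym_pp_def)

lemma bounded_bilinear_matrix_vector_mult: "bounded_bilinear ((*v) :: mat3 \<Rightarrow> real^3 \<Rightarrow> real^3)"
proof -
  have "bilinear ((*v) :: mat3 \<Rightarrow> real^3 \<Rightarrow> real^3)"
    unfolding bilinear_def
    by (auto intro!: linearI simp: matrix_vector_mult_def vec_eq_iff
        sum.distrib algebra_simps sum_distrib_left)
  then show ?thesis by (simp add: bilinear_conv_bounded_bilinear)
qed

lemma Sym_pp_coercive:
  assumes "V \<in> Sym_pp"
  obtains l where "l > 0" "\<And>x. x \<bullet> (V *v x) \<ge> l * (norm x)\<^sup>2"
proof -
  obtain Q v where Q: "rotation_matrix Q" and V: "V = conj_mat Q (diag_mat v)" and v: "\<And>i. v $ i > 0"
    using Sym_pp_diagonalization[OF assms] by metis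
  define l where "l = Min (range (($) v))"
  have "l > 0" unfolding l_def using v by (subst Min_gr_iff) auto
  moreover have "x \<bullet> (V *v x) \<ge> l * (norm x)\<^sup>2" for x
  proof -
    let ?y = "transpose Q *v x"
    have "?y \<bullet> ?y = x \<bullet> ((Q ** transpose Q) *v x)"
      by (simp add: matrix_vector_mul_assoc[symmetric] dot_lmul_matrix[symmetric])
    then have "(norm x)\<^sup>2 = ?y \<bullet> ?y"
      using rotation_orthogonal[OF Q] by (simp add: orthogonal_matrix_def power2_norm_eq_inner)
    then have "l * (norm x)\<^sup>2 = (\<Sum>i\<in>UNIV. l * (?y $ i)\<^sup>2)"
      by (simp add: inner_vec_def power2_eq_square sum_distrib_left)
    also have "\<dots> \<le> (\<Sum>i\<in>UNIV. v $ i * (?y $ i)\<^sup>2)"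
      unfolding l_def by (intro sum_mono mult_right_mono Min_le) auto
    also have "\<dots> = x \<bullet> (V *v x)"
      by (simp add: V conj_mat_quadratic diag_mat_quadratic)
    finally show ?thesis .
  qed
  ultimately show ?thesis using that by blast
qed

text \<open>A perturbation of norm below \<open>l / K\<close> changes the quadratic form by less
  than \<open>l * (norm x)\<^sup>2\<close>, its lower bound at \<open>V\<close>.\<close>

lemma Sym_pp_open_in_Sym:
  assumes "V \<in> Sym_pp"
  obtains d where "d > 0" "\<And>X. X \<in> Sym \<Longrightarrow> norm (X - V) < d \<Longrightarrow> X \<in> Sym_pp"
proof -
  obtain l where l: "l > 0" "\<And>x. x \<bullet> (V *v x) \<ge> l * (norm x)\<^sup>2"
    using Sym_pp_coercive[OF assms] by blast
  obtain K where K: "K > 0" "\<And>(A::mat3) (x::real^3). norm (A *v x) \<le> norm A * norm x * K"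
    using bounded_bilinear.pos_bounded[OF bounded_bilinear_matrix_vector_mult] by blast
  have "X \<in> Sym_pp" if X: "X \<in> Sym" "norm (X - V) < l / K" for X
  proof -
    have "x \<bullet> (X *v x) > 0" if x: "x \<noteq> 0" for x
    proof -
      have "\<bar>x \<bullet> ((X - V) *v x)\<bar> \<le> norm x * (norm (X - V) * norm x * K)"
        by (rule order_trans[OF Cauchy_Schwarz_ineq2]) (intro mult_left_mono K norm_ge_zero)
      also have "\<dots> = (norm (X - V) * K) * (norm x)\<^sup>2"
        by (simp add: power2_eq_square)
      also have "\<dots> < l * (norm x)\<^sup>2"
        using X(2) K(1) x by (intro mult_strict_right_mono) (auto simp: field_simps)
      finally have "x \<bullet> ((X - V) *v x) > - (l * (norm x)\<^sup>2)" by simp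
      then show ?thesis
        using l(2)[of x] by (simp add: matrix_vector_mult_diff_rdistrib inner_diff_right)
    qed
    then show ?thesis using X(1) by (simp add: Sym_pp_def)
  qed
  then show ?thesis using that[of "l / K"] l(1) K(1) by simp
qed

lemma eventually_Sym_pp:
  fixes c :: "real \<Rightarrow> mat3"
  assumes "isCont c t0" "c t0 \<in> Sym_pp" "\<And>t. c t \<in> Sym"
  shows "eventually (\<lambda>t. c t \<in> Sym_pp) (nhds t0)"
proof -
  obtain d where d: "d > 0" "\<And>X. X \<in> Sym \<Longrightarrow> norm (X - c t0) < d \<Longrightarrow> X \<in> Sym_pp"
    using Sym_pp_open_in_Sym[OF assms(2)] by blast
  have "(c \<longlongrightarrow> c t0) (nhds t0)"
    using assms(1) by (simp add: isCont_def tendsto_at_iff_tendsto_nhds)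
  then have "eventually (\<lambda>t. dist (c t) (c t0) < d) (nhds t0)"
    using d(1) by (rule tendstoD)
  then show ?thesis
    by eventually_elim (simp add: d(2) assms(3) dist_norm)
qed

lemma eventually_Sym_pp_segment:
  assumes "V \<in> Sym_pp" "H \<in> Sym"
  shows "eventually (\<lambda>t. V + t *\<^sub>R H \<in> Sym_pp) (nhds (0::real))"
  using assms Sym_pp_subset_Sym
  by (intro eventually_Sym_pp) (auto intro!: continuous_intros Sym_simps)

text \<open>Used for laws differentiable only within \<open>Sym\<close> or \<open>Sym_pp\<close>,
  which have empty interior among all matrices: a curve that stays in the set near \<open>t0\<close>
  still yields an ordinary two-sided derivative.\<close>

lemma has_derivative_within_chain_curve:
  fixes c :: "real \<Rightarrow> 'a::real_normed_vector"
  assumes f: "(f has_derivative T) (at (c t0) within X)"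
    and c: "(c has_vector_derivative c') (at t0)"
    and ev: "eventually (\<lambda>t. c t \<in> X) (nhds t0)"
  shows "((\<lambda>t. f (c t)) has_vector_derivative T c') (at t0)"
proof -
  from ev obtain U where U: "open U" "t0 \<in> U" and UX: "\<forall>t\<in>U. c t \<in> X"
    unfolding eventually_nhds by (elim exE conjE)
  have "(f has_derivative T) (at (c t0) within c ` U)"
    by (rule has_derivative_subset[OF f]) (use UX in blast)
  then have "((f \<circ> c) has_vector_derivative T c') (at t0 within U)"
    by (rule vector_derivative_diff_chain_within[OF has_vector_derivative_at_within[OF c]])
  then show ?thesis unfolding at_within_open[OF U(2,1)] o_def .
qed

lemma segment_has_vector_derivative:
  "((\<lambda>t. V + t *\<^sub>R H) has_vector_derivative H) (at t0)"
  using has_derivative_add[OF has_derivative_const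
      bounded_linear_imp_has_derivative[OF bounded_linear_scaleR_left[of H]], of V "at t0"]
  by (simp add: has_vector_derivative_def)

lemma has_derivative_within_directional:
  assumes "(f has_derivative T) (at V within X)" "eventually (\<lambda>t. V + t *\<^sub>R H \<in> X) (nhds (0::real))"
  shows "((\<lambda>t. f (V + t *\<^sub>R H)) has_vector_derivative T H) (at 0)"
  using has_derivative_within_chain_curve[of f T "\<lambda>t. V + t *\<^sub>R H" 0 X,
      OF _ segment_has_vector_derivative assms(2)] assms(1) by simp

lemma inner_transpose_mat3: "transpose X \<bullet> transpose Y = X \<bullet> Y" for X Y :: mat3
  by (simp add: inner_vec_def transpose_def sum_3)

text \<open>The first bound applies the quadratic form to each column of \<open>Y\<close>; the
  second follows from it by transposition.\<close>

lemma matrix_mult_coercive: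
  fixes Y :: mat3
  assumes "\<And>x. x \<bullet> (V *v x) \<ge> l * (norm x)\<^sup>2"
  shows "(V ** Y) \<bullet> Y \<ge> l * (norm Y)\<^sup>2"
    and "V \<in> Sym \<Longrightarrow> (Y ** V) \<bullet> Y \<ge> l * (norm Y)\<^sup>2"
proof -
  have *: "(V ** Y) \<bullet> Y \<ge> l * (norm Y)\<^sup>2" for Y :: mat3
  proof -
    have "l * (norm Y)\<^sup>2 = (\<Sum>j\<in>UNIV. l * (norm (column j Y))\<^sup>2)"
      unfolding power2_norm_eq_inner by (simp add: inner_vec_def column_def sum_3 distrib_left)
    also have "\<dots> \<le> (\<Sum>j\<in>UNIV. column j Y \<bullet> (V *v column j Y))"
      by (intro sum_mono assms)
    also have "\<dots> = (V ** Y) \<bullet> Y"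
      by (simp add: inner_vec_def column_def sum_3 matrix_vector_mult_def matrix_matrix_mult_def algebra_simps)
    finally show ?thesis .
  qed
  then show "(V ** Y) \<bullet> Y \<ge> l * (norm Y)\<^sup>2" .
  assume "V \<in> Sym"
  then have "(Y ** V) \<bullet> Y = (V ** transpose Y) \<bullet> transpose Y"
    using inner_transpose_mat3[of "Y ** V" Y] by (simp add: transpose_simps Sym_def)
  moreover have "(norm (transpose Y))\<^sup>2 = (norm Y)\<^sup>2"
    by (simp add: power2_norm_eq_inner inner_transpose_mat3)
  ultimately show "(Y ** V) \<bullet> Y \<ge> l * (norm Y)\<^sup>2"
    using *[of "transpose Y"] by simp
qed

text \<open>With \<open>\<Delta> = U(t) - V\<close> one has \<open>U \<Delta> + \<Delta> V = B(t) - B(t0)\<close>, which bounds \<open>\<Delta>\<close> by coercivity, and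
  \<open>V (\<Delta> - hX) + (\<Delta> - hX) V = B(t) - B(t0) - h B' - \<Delta>\<^sup>2\<close>.\<close>

lemma square_root_curve_derivative:
  fixes U B :: "real \<Rightarrow> mat3"
  assumes U: "eventually (\<lambda>t. U t \<in> Sym_pp \<and> U t ** U t = B t) (nhds t0)"
    and B: "(B has_vector_derivative B') (at t0)"
    and X: "U t0 ** X + X ** U t0 = B'"
  shows "(U has_vector_derivative X) (at t0)"
proof -
  define V where "V = U t0"
  have V: "V \<in> Sym_pp" "V ** V = B t0"
    using eventually_nhds_x_imp_x[OF U] by (auto simp: V_def)
  then have VS: "V \<in> Sym" using Sym_pp_subset_Sym by auto
  obtain l where l: "l > 0" "\<And>x. x \<bullet> (V *v x) \<ge> l * (norm x)\<^sup>2"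
    using Sym_pp_coercive[OF V(1)] by blast
  obtain K where K: "K > 0" "\<And>(a::mat3) (b::mat3). norm (a ** b) \<le> norm a * norm b * K"
    using bounded_bilinear.pos_bounded[OF bounded_bilinear_matrix_mult] by blast
  define e where "e = (\<lambda>t. norm (B t - B t0 - (t - t0) *\<^sub>R B') / norm (t - t0))"
  have e: "(e \<longlongrightarrow> 0) (at t0)"
    using B unfolding has_vector_derivative_def has_derivative_iff_norm e_def by simp
  have Bcont: "((\<lambda>t. norm (B t - B t0)) \<longlongrightarrow> 0) (at t0)"
    using has_vector_derivative_continuous[OF B]
    by (simp add: continuous_at LIM_zero tendsto_norm_zero)
  \<comment> \<open>Bound for the normalised remainder of \<open>U\<close>: \<open>e\<close> carries
    the remainder of \<open>B\<close>, and the product term carries the square of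
    \<open>U t - V\<close>. Both tend to 0.\<close>
  define g where "g = (\<lambda>t. (e t + K / l\<^sup>2 * (norm (B t - B t0) * (e t + norm B'))) / l)"
  have g: "(g \<longlongrightarrow> 0) (at t0)"
    unfolding g_def by (rule tendsto_eq_intros e Bcont refl | use l(1) in simp)+
  have bound: "norm (norm (U t - U t0 - (t - t0) *\<^sub>R X) / norm (t - t0)) \<le> g t"
    if t: "t \<noteq> t0" and Ut: "U t \<in> Sym_pp" "U t ** U t = B t" for t
  proof -
    define \<Delta> h where "\<Delta> = U t - V" and "h = t - t0"
    have h: "\<bar>h\<bar> > 0" using t by (simp add: h_def)
    have eq: "U t ** \<Delta> + \<Delta> ** V = B t - B t0"
      by (simp add: \<Delta>_def mm_simps Ut(2) V(2))
    \<comment> \<open>The constant \<open>u\<close> varies with \<open>t\<close>, so only the sign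
      of this term is kept; the uniform constant \<open>l\<close> comes from
      \<open>V\<close>.\<close>
    obtain u where u: "u > 0" "\<And>x. x \<bullet> (U t *v x) \<ge> u * (norm x)\<^sup>2"
      using Sym_pp_coercive[OF Ut(1)] by blast
    have "(U t ** \<Delta>) \<bullet> \<Delta> \<ge> 0"
      by (rule order_trans[OF _ matrix_mult_coercive(1)[OF u(2)]]) (use u(1) in simp)
    then have "l * (norm \<Delta>)\<^sup>2 \<le> (U t ** \<Delta> + \<Delta> ** V) \<bullet> \<Delta>"
      using matrix_mult_coercive(2)[OF l(2) VS, of \<Delta>] unfolding inner_add_left by linarith
    also note eq
    also have "(B t - B t0) \<bullet> \<Delta> \<le> norm (B t - B t0) * norm \<Delta>" by (rule norm_cauchy_schwarz)
    finally have \<Delta>: "norm \<Delta> \<le> norm (B t - B t0) / l"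
      using l(1) by (cases "norm \<Delta> = 0") (auto simp: power2_eq_square field_simps)
    define Z where "Z = \<Delta> - h *\<^sub>R X"
    have eq: "V ** Z + Z ** V = (B t - B t0) - h *\<^sub>R B' - \<Delta> ** \<Delta>"
      unfolding X[symmetric] V_def[symmetric]
      by (simp add: Z_def \<Delta>_def mm_simps Ut(2) V(2) scaleR_add_right)
    have "2 * (l * (norm Z)\<^sup>2) \<le> (V ** Z + Z ** V) \<bullet> Z"
      using matrix_mult_coercive(1)[OF l(2), of Z] matrix_mult_coercive(2)[OF l(2) VS, of Z]
      unfolding inner_add_left by linarith
    also note eq
    also have "((B t - B t0) - h *\<^sub>R B' - \<Delta> ** \<Delta>) \<bullet> Z \<le> norm ((B t - B t0) - h *\<^sub>R B' - \<Delta> ** \<Delta>) * norm Z" by (rule norm_cauchy_schwarz)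
    finally have "2 * l * norm Z \<le> norm ((B t - B t0) - h *\<^sub>R B' - \<Delta> ** \<Delta>)"
      by (cases "norm Z = 0") (auto simp: power2_eq_square)
    also have "\<dots> \<le> norm ((B t - B t0) - h *\<^sub>R B') + norm (\<Delta> ** \<Delta>)" by (rule norm_triangle_ineq4)
    also have "norm ((B t - B t0) - h *\<^sub>R B') = e t * \<bar>h\<bar>"
      using h by (simp add: e_def h_def)
    also have "norm (\<Delta> ** \<Delta>) \<le> norm \<Delta> * norm \<Delta> * K" by (rule K)
    also have "norm \<Delta> * norm \<Delta> * K \<le> (norm (B t - B t0) / l) * (norm (B t - B t0) / l) * K"
      using \<Delta> K(1) l(1) by (intro mult_mono) auto
    finally have "2 * l * norm Z \<le> e t * \<bar>h\<bar> + (norm (B t - B t0) / l) * (norm (B t - B t0) / l) * K"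
      by simp
    also have "(norm (B t - B t0) / l) * (norm (B t - B t0) / l) * K
      = K / l\<^sup>2 * (norm (B t - B t0) * norm (B t - B t0))"
      by (simp add: power2_eq_square)
    \<comment> \<open>One factor \<open>norm (B t - B t0)\<close> is traded for a multiple of
      \<open>\<bar>h\<bar>\<close>, the other is kept because it tends to 0.\<close>
    also have "\<dots> \<le> K / l\<^sup>2 * (norm (B t - B t0) * ((e t + norm B') * \<bar>h\<bar>))"
    proof (intro mult_left_mono)
      have "norm (B t - B t0) \<le> norm ((B t - B t0) - h *\<^sub>R B') + norm (h *\<^sub>R B')"
        using norm_triangle_ineq[of "(B t - B t0) - h *\<^sub>R B'" "h *\<^sub>R B'"] by simp
      then show "norm (B t - B t0) \<le> (e t + norm B') * \<bar>h\<bar>"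
        using h by (simp add: e_def h_def distrib_right distrib_left mult.commute)
    qed (use K(1) in auto)
    finally have "2 * l * norm Z \<le> (e t + K / l\<^sup>2 * (norm (B t - B t0) * (e t + norm B'))) * \<bar>h\<bar>"
      by (simp add: algebra_simps)
    moreover have "l * norm Z \<le> 2 * l * norm Z" using l(1) by simp
    ultimately have "l * norm Z \<le> (e t + K / l\<^sup>2 * (norm (B t - B t0) * (e t + norm B'))) * \<bar>h\<bar>"
      by linarith
    also have "\<dots> = (l * g t) * \<bar>h\<bar>" using l(1) by (simp add: g_def)
    finally have "l * norm Z \<le> (l * g t) * \<bar>h\<bar>" .
    then have "norm Z \<le> g t * \<bar>h\<bar>" using l(1) by (simp add: mult.assoc)
    then show ?thesis using h by (simp add: Z_def \<Delta>_def h_def V_def divide_le_eq)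
  qed
  have "((\<lambda>t. norm (U t - U t0 - (t - t0) *\<^sub>R X) / norm (t - t0)) \<longlongrightarrow> 0) (at t0)"
  proof (rule Lim_null_comparison[OF _ g])
    show "eventually (\<lambda>t. norm (norm (U t - U t0 - (t - t0) *\<^sub>R X) / norm (t - t0)) \<le> g t) (at t0)"
      unfolding eventually_at_filter
      using U by eventually_elim (use bound in blast)
  qed
  then show ?thesis
    unfolding has_vector_derivative_def has_derivative_iff_norm
    by (simp add: bounded_linear_scaleR_left)
qed

section \<open>Differentiating the isotropy relation\<close>

lemma skew_decomposition:
  assumes "transpose W = - W"
  shows "W = (W $ 2 $ 1) *\<^sub>R plane_gen 1 2 + (W $ 3 $ 1) *\<^sub>R plane_gen 1 3 + (W $ 3 $ 2) *\<^sub>R plane_gen 2 3"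
proof -
  have "W $ j $ i = - W $ i $ j" for i j
    using arg_cong[OF assms, of "\<lambda>M. M $ i $ j"] by (simp add: transpose_def)
  from this[of 1 1] this[of 2 2] this[of 3 3] this[of 1 2] this[of 1 3] this[of 2 3]
  show ?thesis by (simp add: vec_eq_iff forall_3 plane_gen_def)
qed

text \<open>Differentiating the isotropy relation along plane rotations at the identity gives the
  claim for their generators, and linearity extends it to every skew \<open>W\<close>.\<close>

lemma isotropic_derivative_commutator:
  assumes iso: "isotropic \<tau>" and V: "V \<in> Sym_pp"
    and T: "(\<tau> has_derivative T) (at V within Sym_pp)"
    and W: "transpose W = - W"
  shows "T (W ** V - V ** W) = W ** \<tau> V - \<tau> V ** W"
proof -
  have gen: "T (plane_gen i j ** V - V ** plane_gen i j) = plane_gen i j ** \<tau> V - \<tau> V ** plane_gen i j"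
    if ij: "i \<noteq> j" for i j
  proof -
    let ?R = "plane_rot i j"
    have R: "rotation_matrix (?R t)" for t by (rule plane_rot_rotation[OF ij])
    have R0: "conj_mat (?R 0) V = V" by (simp add: plane_rot_0 conj_mat_def transpose_mat)
    have 1: "((\<lambda>t. \<tau> (conj_mat (?R t) V)) has_vector_derivative
      T (plane_gen i j ** V - V ** plane_gen i j)) (at 0)"
      by (rule has_derivative_within_chain_curve[where X = Sym_pp])
        (use T V R R0 plane_rot_conj_derivative[OF ij] conj_mat_Sym_pp[OF rotation_orthogonal] in auto)
    have 2: "\<tau> (conj_mat (?R t) V) = conj_mat (?R t) (\<tau> V)" for t
      using iso V R by (simp add: isotropic_def conj_mat_def)
    show ?thesis
      using vector_derivative_unique_at[OF 1[unfolded 2] plane_rot_conj_derivative[OF ij]] .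
  qed
  have lin: "linear T" using T by (rule has_derivative_linear)
  obtain a b c where W': "W = a *\<^sub>R plane_gen 1 2 + b *\<^sub>R plane_gen 1 3 + c *\<^sub>R plane_gen 2 3"
    using skew_decomposition[OF W] by blast
  have "W ** A - A ** W = a *\<^sub>R (plane_gen 1 2 ** A - A ** plane_gen 1 2)
    + b *\<^sub>R (plane_gen 1 3 ** A - A ** plane_gen 1 3) + c *\<^sub>R (plane_gen 2 3 ** A - A ** plane_gen 2 3)" for A
    unfolding W' by (simp add: mm_simps algebra_simps)
  then show ?thesis
    by (simp add: linear_add[OF lin] linear_cmul[OF lin] gen)
qed

text \<open>Since \<open>P\<close> fixes \<open>V\<close>, conjugation by \<open>P\<close> maps the
  line through \<open>V\<close> in direction \<open>H\<close> to the line in direction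
  \<open>conj_mat P H\<close>; isotropy relates the values of \<open>\<tau>\<close> on the two
  lines.\<close>

lemma isotropic_derivative_stabiliser:
  assumes iso: "isotropic \<tau>" and V: "V \<in> Sym_pp"
    and T: "(\<tau> has_derivative T) (at V within Sym_pp)"
    and P: "rotation_matrix P" "conj_mat P V = V" and H: "H \<in> Sym"
  shows "T (conj_mat P H) = conj_mat P (T H)"
proof -
  have 1: "((\<lambda>t. \<tau> (V + t *\<^sub>R conj_mat P H)) has_vector_derivative T (conj_mat P H)) (at 0)"
    by (intro has_derivative_within_directional[OF T] eventually_Sym_pp_segment V conj_mat_Sym H)
  have 2: "((\<lambda>t. conj_mat P (\<tau> (V + t *\<^sub>R H))) has_vector_derivative conj_mat P (T H)) (at 0)"
    by (intro bounded_linear.has_vector_derivative[OF bounded_linear_conj_mat]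
        has_derivative_within_directional[OF T] eventually_Sym_pp_segment V H)
  \<comment> \<open>Isotropy is available only while \<open>V + t *\<^sub>R H\<close> is positive
    definite, hence near 0.\<close>
  have ev: "eventually (\<lambda>t. conj_mat P (\<tau> (V + t *\<^sub>R H)) = \<tau> (V + t *\<^sub>R conj_mat P H)) (nhds (0::real))"
    using eventually_Sym_pp_segment[OF V H]
  proof eventually_elim
    case (elim t)
    have "V + t *\<^sub>R conj_mat P H = conj_mat P (V + t *\<^sub>R H)"
      by (simp add: conj_mat_simps P(2))
    then show ?case using iso elim P(1) by (simp add: isotropic_def conj_mat_def)
  qed
  have "((\<lambda>t. \<tau> (V + t *\<^sub>R conj_mat P H)) has_vector_derivative conj_mat P (T H)) (at 0)"
    using 2 ev has_vector_derivative_cong_ev[where x = 0 and S = UNIV and f = "\<lambda>t. conj_mat P (\<tau> (V + t *\<^sub>R H))"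
      and g = "\<lambda>t. \<tau> (V + t *\<^sub>R conj_mat P H)"] eventually_nhds_x_imp_x[OF ev] by simp
  then show ?thesis using vector_derivative_unique_at 1 by blast
qed

subsection \<open>Equivariant maps and entrywise multipliers\<close>

text \<open>Half-turn about the \<open>k\<close>-th axis. Two signs change because a single sign
  change has determinant -1. It commutes with diagonal matrices, so it stabilises a diagonal
  \<open>V\<close>.\<close>

definition flip :: "3 \<Rightarrow> mat3"
  where "flip k = diag_mat (\<chi> i. if i = k then 1 else -1)"

text \<open>Indexed by the axis it avoids, so that \<open>flip l\<close> fixes it for
  \<open>l = k\<close> and negates it otherwise.\<close>

definition offdiag :: "3 \<Rightarrow> mat3"
  where "offdiag k = (\<chi> i j. if i \<noteq> j \<and> i \<noteq> k \<and> j \<noteq> k then 1 else 0)"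

lemma diag_mat_transpose: "transpose (diag_mat d) = diag_mat d"
  using diag_mat_Sym by (simp add: Sym_def)

lemma flip_rotation: "rotation_matrix (flip k)"
proof -
  have "\<forall>k. det (flip k) = 1"
    unfolding forall_3 det_3 by (simp add: flip_def diag_mat_def)
  moreover have "transpose (flip k) ** flip k = mat 1"
  proof -
    have "(\<chi> i. (if i = k then 1 else -1 :: real) * (if i = k then 1 else -1)) = (\<chi> i. 1)"
      by (simp add: vec_eq_iff)
    then show ?thesis
      by (simp add: flip_def diag_mat_transpose diag_mat_mult_diag_mat diag_mat_one cong: if_cong)
  qed
  ultimately show ?thesis by (simp add: rotation_matrix_def orthogonal_matrix)
qed

lemma conj_flip_nth:
  "conj_mat (flip k) H $ i $ j = (if i = k then 1 else -1) * (if j = k then 1 else -1) * H $ i $ j"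
  by (simp add: conj_mat_def flip_def diag_mat_transpose diag_mat_mult_nth mult_diag_mat_nth)

lemma conj_flip_diag_mat: "conj_mat (flip k) (diag_mat d) = diag_mat d"
  by (simp add: vec_eq_iff conj_flip_nth diag_mat_def)

lemma conj_flip_offdiag: "conj_mat (flip l) (offdiag k) = (if l = k then offdiag k else - offdiag k)"
proof -
  have "\<forall>l k. conj_mat (flip l) (offdiag k) = (if l = k then offdiag k else - offdiag k)"
    unfolding forall_3 vec_eq_iff conj_flip_nth offdiag_def by simp
  then show ?thesis by blast
qed

lemma offdiag_Sym: "offdiag k \<in> Sym"
  by (auto simp: Sym_def offdiag_def transpose_def vec_eq_iff)

lemma Sym_nth_commute: "H \<in> Sym \<Longrightarrow> H $ i $ j = H $ j $ i"
  unfolding Sym_def by (metis (mono_tags) mem_Collect_eq transpose_def vec_lambda_beta)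

lemma Sym_decomposition:
  assumes "H \<in> Sym"
  shows "H = diag_mat (\<chi> i. H $ i $ i) + (H $ 2 $ 3) *\<^sub>R offdiag 1
    + (H $ 1 $ 3) *\<^sub>R offdiag 2 + (H $ 1 $ 2) *\<^sub>R offdiag 3"
  using Sym_nth_commute[OF assms, of 2 1] Sym_nth_commute[OF assms, of 3 1] Sym_nth_commute[OF assms, of 3 2]
  by (simp add: vec_eq_iff forall_3 diag_mat_def offdiag_def)

text \<open>Abstracts the derivative of an isotropic law at \<open>V\<close>, written in an
  eigenbasis of \<open>V\<close>, where the half-turns about the axes stabilise
  \<open>V\<close>.\<close>

locale flip_equivariant =
  fixes T :: "mat3 \<Rightarrow> mat3"
  assumes linear_T: "linear T"
    and T_flip: "\<And>k H. H \<in> Sym \<Longrightarrow> T (conj_mat (flip k) H) = conj_mat (flip k) (T H)"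
begin

lemma T_flip_inner: "H \<in> Sym \<Longrightarrow> T H \<bullet> G = T (conj_mat (flip k) H) \<bullet> conj_mat (flip k) G"
  by (simp add: T_flip inner_conj_mat_conj_mat rotation_orthogonal flip_rotation)

text \<open>A half-turn about an axis other than \<open>k\<close> fixes diagonal matrices and
  negates \<open>offdiag k\<close>, so each pairing equals its own negative.\<close>

lemma T_diag_offdiag: "T (diag_mat d) \<bullet> offdiag k = 0" "T (offdiag k) \<bullet> diag_mat d = 0"
proof -
  obtain l where "l \<noteq> k" using exhaust_3[of k] by (metis zero_neq_one zero_neq_numeral)
  then show "T (diag_mat d) \<bullet> offdiag k = 0" "T (offdiag k) \<bullet> diag_mat d = 0"
    using T_flip_inner[OF diag_mat_Sym, of d "offdiag k" l] T_flip_inner[OF offdiag_Sym, of k "diag_mat d" l]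
    by (simp_all add: conj_flip_diag_mat conj_flip_offdiag linear_neg[OF linear_T])
qed

lemma T_offdiag_offdiag: "k \<noteq> l \<Longrightarrow> T (offdiag k) \<bullet> offdiag l = 0"
  using T_flip_inner[OF offdiag_Sym, of k "offdiag l" k] by (simp add: conj_flip_offdiag)

lemma T_quadratic:
  assumes m: "\<And>a b. m a b = m b a" and H: "H \<in> Sym"
  shows "T (spectral_mult m s H) \<bullet> H
    = T (diag_mat (\<chi> i. m (s $ i) (s $ i) * H $ i $ i)) \<bullet> diag_mat (\<chi> i. H $ i $ i)
      + m (s $ 2) (s $ 3) * (H $ 2 $ 3)\<^sup>2 * (T (offdiag 1) \<bullet> offdiag 1)
      + m (s $ 1) (s $ 3) * (H $ 1 $ 3)\<^sup>2 * (T (offdiag 2) \<bullet> offdiag 2)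
      + m (s $ 1) (s $ 2) * (H $ 1 $ 2)\<^sup>2 * (T (offdiag 3) \<bullet> offdiag 3)"
proof -
  let ?M = "spectral_mult m s H"
  have "T ?M = T (diag_mat (\<chi> i. ?M $ i $ i)) + (?M $ 2 $ 3) *\<^sub>R T (offdiag 1)
    + (?M $ 1 $ 3) *\<^sub>R T (offdiag 2) + (?M $ 1 $ 2) *\<^sub>R T (offdiag 3)"
    by (subst Sym_decomposition[OF spectral_mult_Sym[of m, OF m H, of s]])
      (simp add: linear_add[OF linear_T] linear_cmul[OF linear_T])
  from arg_cong2[where f = inner, OF this Sym_decomposition[OF H]]
  have "T ?M \<bullet> H = T (diag_mat (\<chi> i. ?M $ i $ i)) \<bullet> diag_mat (\<chi> i. H $ i $ i)
    + ?M $ 2 $ 3 * (H $ 2 $ 3 * (T (offdiag 1) \<bullet> offdiag 1))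
    + ?M $ 1 $ 3 * (H $ 1 $ 3 * (T (offdiag 2) \<bullet> offdiag 2))
    + ?M $ 1 $ 2 * (H $ 1 $ 2 * (T (offdiag 3) \<bullet> offdiag 3))"
    by (simp only: inner_add_left inner_add_right inner_scaleR_left inner_scaleR_right T_diag_offdiag)
      (simp add: T_offdiag_offdiag)
  then show ?thesis
    by (simp add: spectral_mult_def power2_eq_square mult.assoc)
qed

text \<open>Scaling the entries of \<open>H\<close> by the square root of \<open>m' / m\<close>
  turns one quadratic form into the other: each off-diagonal entry enters only through its square.
  The diagonal entries may be coupled by \<open>T\<close>, but there the scaling factor is
  1.\<close>

lemma T_positive_change_multiplier:
  assumes m: "\<And>a b. m a b = m b a" "\<And>a b. m a b > 0"
    and m': "\<And>a b. m' a b = m' b a" "\<And>a b. m' a b > 0"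
    and diag: "\<And>a. m a a = m' a a"
    and pos: "\<And>D. D \<in> Sym \<Longrightarrow> D \<noteq> 0 \<Longrightarrow> T (spectral_mult m s D) \<bullet> D > 0"
    and H: "H \<in> Sym" "H \<noteq> 0"
  shows "T (spectral_mult m' s H) \<bullet> H > 0"
proof -
  define r where "r = (\<lambda>a b. sqrt (m' a b / m a b))"
  define D where "D = spectral_mult r s H"
  have r: "r a b > 0" "m a b * (r a b)\<^sup>2 = m' a b" "r a b = r b a" "r a a = 1" for a b
    using m(2)[of a b] m(2)[of a a] m'(2)[of a b] m(1)[of a b] m'(1)[of a b] diag[of a] by (auto simp: r_def)
  have D: "D \<in> Sym" unfolding D_def by (rule spectral_mult_Sym) (use r H in auto)
  have "D \<noteq> 0"
  proof
    assume "D = 0"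
    then have "D $ i $ j = 0" for i j by simp
    then have "r (s $ i) (s $ j) * H $ i $ j = 0" for i j
      unfolding D_def spectral_mult_def by simp
    then have "H $ i $ j = 0" for i j
      using r(1)[of "s $ i" "s $ j"] by (metis less_irrefl mult_eq_0_iff)
    then show False using H(2) by (simp add: vec_eq_iff)
  qed
  have "m a b * (r a b * h)\<^sup>2 = m' a b * h\<^sup>2" for a b h
    using r(2)[of a b] by (simp add: power_mult_distrib)
  then have "T (spectral_mult m s D) \<bullet> D = T (spectral_mult m' s H) \<bullet> H"
    unfolding T_quadratic[of m, OF m(1) D] T_quadratic[of m', OF m'(1) H(1)]
    by (simp add: D_def spectral_mult_def r(4) diag)
  then show ?thesis using pos[OF D \<open>D \<noteq> 0\<close>] by simp
qed

end

text \<open>With eigenvalues \<open>exp a\<close> and \<open>exp b\<close> of \<open>V\<close>, the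
  factor by which the solution \<open>K\<close> of
  \<open>V ** K + K ** V = D ** (V ** V) + (V ** V) ** D\<close> scales the corresponding entry of
  \<open>D\<close>.\<close>

definition lyapunov_mult :: "real \<Rightarrow> real \<Rightarrow> real"
  where "lyapunov_mult a b = ((exp a)\<^sup>2 + (exp b)\<^sup>2) / (exp a + exp b)"

lemma lyapunov_mult_pos: "lyapunov_mult a b > 0"
  by (auto simp: lyapunov_mult_def intro!: divide_pos_pos add_pos_pos)

lemma lyapunov_mult_commute: "lyapunov_mult a b = lyapunov_mult b a"
  by (simp add: lyapunov_mult_def add.commute)

lemma lyapunov_mult_refl: "lyapunov_mult a a = exp a"
  by (simp add: lyapunov_mult_def power2_eq_square)

lemma lyapunov_mult_solves:
  fixes Q D :: mat3 and s :: "real^3"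
  assumes Q: "orthogonal_matrix Q"
  defines "V \<equiv> conj_mat Q (diag_mat (\<chi> i. exp (s $ i)))"
    and "K \<equiv> conj_mat Q (spectral_mult lyapunov_mult s (conj_mat (transpose Q) D))"
  shows "V ** K + K ** V = D ** (V ** V) + (V ** V) ** D"
proof -
  let ?v = "(\<chi> i. exp (s $ i)) :: real^3" and ?D = "conj_mat (transpose Q) D"
  let ?K = "spectral_mult lyapunov_mult s ?D"
  have D: "D = conj_mat Q ?D" by (simp add: conj_mat_inverse[OF Q])
  have pt: "(exp a + exp b) * (lyapunov_mult a b * d) = (exp a * exp a + exp b * exp b) * d" for a b d
    using add_pos_pos[OF exp_gt_zero[of a] exp_gt_zero[of b]]
    by (simp add: lyapunov_mult_def power2_eq_square)
  have "(diag_mat ?v ** ?K + ?K ** diag_mat ?v) $ i $ j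
    = (?D ** (diag_mat ?v ** diag_mat ?v) + (diag_mat ?v ** diag_mat ?v) ** ?D) $ i $ j" for i j
    using pt[of "s $ i" "s $ j" "?D $ i $ j"]
    by (simp add: diag_mat_mult_diag_mat diag_mat_mult_nth mult_diag_mat_nth spectral_mult_def algebra_simps)
  then have "diag_mat ?v ** ?K + ?K ** diag_mat ?v
    = ?D ** (diag_mat ?v ** diag_mat ?v) + (diag_mat ?v ** diag_mat ?v) ** ?D"
    unfolding vec_eq_iff by blast
  from arg_cong[OF this, of "conj_mat Q"]
  show ?thesis unfolding V_def K_def
    by (subst (3 4) D) (simp add: conj_mat_simps conj_mat_mult[OF Q])
qed

text \<open>Carried into the eigenbasis, \<open>T\<close> commutes with the half-turns, and the two
  multipliers agree on the diagonal, so they can be exchanged either way. One encodes the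
  Zaremba-Jaumann condition, the other the derivative of the logarithmic law.\<close>

lemma isotropic_multiplier_positivity_iff:
  fixes Q :: mat3 and s :: "real^3"
  defines "V \<equiv> conj_mat Q (diag_mat (\<chi> i. exp (s $ i)))"
  assumes iso: "isotropic \<tau>" and Q: "rotation_matrix Q"
    and T: "(\<tau> has_derivative T) (at V within Sym_pp)"
  defines "P \<equiv> \<lambda>m. \<forall>H\<in>Sym - {0}. T (conj_mat Q (spectral_mult m s (conj_mat (transpose Q) H))) \<bullet> H > 0"
  shows "P lyapunov_mult \<longleftrightarrow> P exp_dd"
proof -
  note orth = rotation_orthogonal[OF Q]
  have V: "V \<in> Sym_pp" by (simp add: V_def conj_mat_Sym_pp_iff orth diag_mat_Sym_pp)
  define T' where "T' = conj_mat (transpose Q) \<circ> (T \<circ> conj_mat Q)"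
  interpret flip_equivariant T'
  proof (rule flip_equivariant.intro)
    show "linear T'"
      unfolding T'_def by (intro linear_compose linear_conj_mat has_derivative_linear[OF T])
    fix k H assume H: "H \<in> Sym"
    \<comment> \<open>The half-turn about the \<open>k\<close>-th eigenvector of \<open>V\<close>, a
      rotation that stabilises \<open>V\<close>.\<close>
    let ?P = "conj_mat Q (flip k)"
    have conjP: "conj_mat ?P (conj_mat Q X) = conj_mat Q (conj_mat (flip k) X)" for X
      unfolding conj_mat_def[of ?P] conj_mat_transpose conj_mat_mult[OF orth, symmetric]
      by (simp add: conj_mat_def[of "flip k"])
    have P: "rotation_matrix ?P"
      unfolding conj_mat_def by (intro rotation_mult rotation_transpose Q flip_rotation)
    have "T (conj_mat ?P (conj_mat Q H)) = conj_mat ?P (T (conj_mat Q H))"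
      by (intro isotropic_derivative_stabiliser[OF iso V T P] conj_mat_Sym H)
        (simp add: V_def conjP conj_flip_diag_mat)
    moreover have "conj_mat ?P Y = conj_mat Q (conj_mat (flip k) (conj_mat (transpose Q) Y))" for Y
      using conjP[of "conj_mat (transpose Q) Y"] by (simp add: conj_mat_inverse[OF orth])
    ultimately show "T' (conj_mat (flip k) H) = conj_mat (flip k) (T' H)"
      by (simp add: T'_def conjP conj_mat_inverse[OF orth])
  qed
  have P: "P m \<longleftrightarrow> (\<forall>H\<in>Sym - {0}. T' (spectral_mult m s H) \<bullet> H > 0)" for m
  proof
    show "\<forall>H\<in>Sym - {0}. T' (spectral_mult m s H) \<bullet> H > 0" if P: "P m"
    proof
      fix H assume H: "H \<in> Sym - {0}"
      then have "conj_mat Q H \<in> Sym - {0}"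
        using conj_mat_Sym conj_mat_inverse(1)[OF orth, of H] by (auto simp: conj_mat_simps)
      from bspec[OF P[unfolded P_def] this] show "T' (spectral_mult m s H) \<bullet> H > 0"
        by (simp add: T'_def conj_mat_inverse[OF orth] inner_conj_mat orth)
    qed
    show "P m" if pos: "\<forall>H\<in>Sym - {0}. T' (spectral_mult m s H) \<bullet> H > 0"
      unfolding P_def
    proof
      fix H assume H: "H \<in> Sym - {0}"
      then have "conj_mat (transpose Q) H \<in> Sym - {0}"
        using conj_mat_Sym conj_mat_inverse(2)[OF orth, of H] by (auto simp: conj_mat_simps)
      from bspec[OF pos this] show "T (conj_mat Q (spectral_mult m s (conj_mat (transpose Q) H))) \<bullet> H > 0"
        by (simp add: T'_def conj_mat_inverse[OF orth] inner_conj_mat orth)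
    qed
  qed
  have "lyapunov_mult a a = exp_dd a a" for a
    by (simp add: lyapunov_mult_refl exp_dd_refl)
  then show ?thesis
    unfolding P
    using T_positive_change_multiplier[of lyapunov_mult exp_dd s]
      T_positive_change_multiplier[of exp_dd lyapunov_mult s]
      lyapunov_mult_commute lyapunov_mult_pos exp_dd_commute exp_dd_pos
    by (metis DiffD1 DiffD2 DiffI singletonI singletonD)
qed

subsection \<open>The Zaremba-Jaumann rate\<close>

lemma
  fixes A :: mat3
  assumes "det A \<noteq> 0"
  shows matrix_inv_right: "A ** matrix_inv A = mat 1"
    and matrix_inv_left: "matrix_inv A ** A = mat 1"
proof -
  have "\<exists>B. A ** B = mat 1 \<and> B ** A = mat 1"
    using assms by (simp add: invertible_det_nz[symmetric] invertible_def)
  then have "A ** matrix_inv A = mat 1 \<and> matrix_inv A ** A = mat 1"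
    unfolding matrix_inv_def by (rule someI_ex)
  then show "A ** matrix_inv A = mat 1" "matrix_inv A ** A = mat 1" by auto
qed

lemma stretching_Sym: "stretching F t \<in> Sym"
  by (simp add: stretching_def Sym_def transpose_simps add.commute)

lemma vorticity_skew: "transpose (vorticity F t) = - vorticity F t"
  by (simp add: vorticity_def transpose_simps scaleR_diff_right)

text \<open>From \<open>F' = L ** F t\<close> and \<open>L = D + W\<close>, the rate of
  \<open>V\<close> is \<open>K\<close> plus the commutator of \<open>W\<close> and \<open>V\<close>.
  By isotropy \<open>T\<close> sends this commutator to that of \<open>W\<close> and
  \<open>\<tau> V\<close>, which cancels the spin terms of the rate.\<close>

lemma ZJ_rate_isotropic:
  assumes iso: "isotropic \<tau>"
    and T: "(\<tau> has_derivative T) (at V within Sym_pp)"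
    and F: "(F has_vector_derivative F') (at t)" "eventually (\<lambda>s. F s \<in> GL_plus) (nhds t)"
    and V: "V = left_stretch (F t)"
    and K: "V ** K + K ** V = stretching F t ** (V ** V) + (V ** V) ** stretching F t"
  shows "ZJ_rate F (\<lambda>s. \<tau> (left_stretch (F s))) t = T K"
proof -
  have Ft: "F t \<in> GL_plus" using F(2) by (rule eventually_nhds_x_imp_x)
  have VB: "V ** V = F t ** transpose (F t)" unfolding V by (rule square_left_stretch[OF Ft])
  define L where "L = F' ** matrix_inv (F t)"
  have L: "velocity_gradient F t = L"
    by (simp add: velocity_gradient_def L_def vector_derivative_at[OF F(1)])
  define D W where "D = stretching F t" and "W = vorticity F t"
  have LDW: "L = D + W" "transpose L = D - W"
    by (simp_all add: D_def W_def stretching_def vorticity_def L scaleR_add_right[symmetric]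
        scaleR_diff_right[symmetric] scaleR_2[symmetric])
  have LF: "L ** F t = F'"
    unfolding L_def matrix_mul_assoc[symmetric]
    using Ft by (subst matrix_inv_left) (auto simp: GL_plus_def)
  define X where "X = K + (W ** V - V ** W)"
  have B: "((\<lambda>s. F s ** transpose (F s)) has_vector_derivative
      F t ** transpose F' + F' ** transpose (F t)) (at t)"
    by (rule mm_has_vector_derivative[OF F(1)
          bounded_linear.has_vector_derivative[OF bounded_linear_transpose_mat3 F(1)]])
  have "V ** X + X ** V = (V ** K + K ** V) + (W ** (V ** V) - (V ** V) ** W)"
    by (simp add: X_def mm_simps matrix_mul_assoc algebra_simps)
  also have "\<dots> = (V ** V) ** (D - W) + (D + W) ** (V ** V)"
    unfolding K D_def[symmetric] by (simp add: mm_simps algebra_simps)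
  also have "\<dots> = F t ** transpose (L ** F t) + (L ** F t) ** transpose (F t)"
    unfolding LDW[symmetric] VB by (simp add: transpose_simps matrix_mul_assoc)
  finally have X: "V ** X + X ** V = F t ** transpose F' + F' ** transpose (F t)"
    unfolding LF .
  have "eventually (\<lambda>s. left_stretch (F s) \<in> Sym_pp \<and>
      left_stretch (F s) ** left_stretch (F s) = F s ** transpose (F s)) (nhds t)"
    using F(2) by eventually_elim (simp add: left_stretch_Sym_pp square_left_stretch)
  from square_root_curve_derivative[OF this B] X
  have U: "((\<lambda>s. left_stretch (F s)) has_vector_derivative X) (at t)"
    by (simp add: V)
  have "((\<lambda>s. \<tau> (left_stretch (F s))) has_vector_derivative T X) (at t)"
    by (rule has_derivative_within_chain_curve[OF _ U])
      (use T V F(2) in \<open>auto elim: eventually_mono intro: left_stretch_Sym_pp\<close>)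
  then have "ZJ_rate F (\<lambda>s. \<tau> (left_stretch (F s))) t = T X + \<tau> V ** W - W ** \<tau> V"
    by (simp add: ZJ_rate_def vector_derivative_at V W_def)
  moreover have "T X = T K + (W ** \<tau> V - \<tau> V ** W)"
    unfolding X_def linear_add[OF has_derivative_linear[OF T]]
    by (subst isotropic_derivative_commutator[OF iso _ T])
      (use left_stretch_Sym_pp[OF Ft] vorticity_skew in \<open>auto simp: V W_def\<close>)
  ultimately show ?thesis by simp
qed

section \<open>Derivatives within the symmetric matrices and self-adjoint parts\<close>

lemma has_derivative_Sym_directional:
  assumes "(f has_derivative G) (at S within Sym)" "S \<in> Sym" "H \<in> Sym"
  shows "((\<lambda>t. f (S + t *\<^sub>R H)) has_vector_derivative G H) (at 0)"
  by (rule has_derivative_within_directional[OF assms(1)]) (simp add: Sym_simps assms(2,3))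

text \<open>Along a symmetric direction any derivative within \<open>Sym\<close> is the derivative
  on a line inside \<open>Sym\<close>, hence independent of the choice made by
  \<open>frechet_derivative\<close>.\<close>

lemma
  assumes f: "(f has_derivative G) (at S within Sym)" and S: "S \<in> Sym"
  shows D_Sym_has_derivative: "(f has_derivative D_Sym f S) (at S within Sym)"
    and D_Sym_eq: "H \<in> Sym \<Longrightarrow> D_Sym f S H = G H"
proof -
  show D: "(f has_derivative D_Sym f S) (at S within Sym)"
    unfolding D_Sym_def by (rule frechet_derivative_works[THEN iffD1, OF differentiableI[OF f]])
  show "D_Sym f S H = G H" if "H \<in> Sym"
    by (rule vector_derivative_unique_at[OF has_derivative_Sym_directional[OF D S that]
          has_derivative_Sym_directional[OF f S that]])
qed

lemma has_derivative_Sym_closed: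
  assumes f: "(f has_derivative G) (at S within Sym)" and S: "S \<in> Sym"
    and maps: "\<And>X. X \<in> Sym \<Longrightarrow> f X \<in> Sym" and H: "H \<in> Sym"
  shows "G H \<in> Sym"
proof -
  note d = has_derivative_Sym_directional[OF f S H]
  have tr: "((\<lambda>t. transpose (f (S + t *\<^sub>R H))) has_vector_derivative transpose (G H)) (at 0)"
    by (rule bounded_linear.has_vector_derivative[OF bounded_linear_transpose_mat3 d])
  have "f (S + t *\<^sub>R H) \<in> Sym" for t
    by (intro maps Sym_simps S H)
  then have eq: "transpose (f (S + t *\<^sub>R H)) = f (S + t *\<^sub>R H)" for t
    unfolding Sym_def by blast
  show ?thesis
    unfolding Sym_def using vector_derivative_unique_at[OF tr[unfolded eq] d] by blast
qed

text \<open>The adjoint on all matrices followed by the orthogonal projection onto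
  \<open>Sym\<close>.\<close>

lemma adjoint_Sym_eq:
  assumes C: "linear C"
  shows "adjoint_Sym C K = (1/2) *\<^sub>R (adjoint C K + transpose (adjoint C K))"
  unfolding adjoint_Sym_def
proof (rule the_equality)
  let ?M = "(1/2) *\<^sub>R (adjoint C K + transpose (adjoint C K))"
  have M: "?M \<in> Sym" by (simp add: Sym_def transpose_simps add.commute)
  have *: "C H \<bullet> K = H \<bullet> ?M" if "H \<in> Sym" for H
  proof -
    have "H \<bullet> transpose (adjoint C K) = H \<bullet> adjoint C K"
      using that inner_transpose_mat3[of H "adjoint C K"] by (simp add: Sym_def)
    then show ?thesis by (simp add: inner_add_right adjoint_works[OF C])
  qed
  with M show "?M \<in> Sym \<and> (\<forall>H\<in>Sym. C H \<bullet> K = H \<bullet> ?M)" by blast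
  fix N assume N: "N \<in> Sym \<and> (\<forall>H\<in>Sym. C H \<bullet> K = H \<bullet> N)"
  \<comment> \<open>Uniqueness: \<open>N - ?M\<close> is symmetric, so it may itself serve as the
    test direction.\<close>
  then have "(N - ?M) \<bullet> N = (N - ?M) \<bullet> ?M"
    using * M by (metis subspace_diff[OF subspace_Sym])
  then have "(N - ?M) \<bullet> (N - ?M) = 0" unfolding inner_diff_right by simp
  then show "N = ?M" by simp
qed

text \<open>On \<open>Sym\<close> the self-adjoint part has the same quadratic form as
  \<open>C\<close>; the remaining clauses of \<open>Sym4_pp\<close> hold by construction.\<close>

lemma sym_part_in_Sym4_pp_iff:
  assumes C: "linear C" and maps: "\<And>H. H \<in> Sym \<Longrightarrow> C H \<in> Sym"
  shows "sym_part C \<in> Sym4_pp \<longleftrightarrow> (\<forall>H\<in>Sym - {0}. C H \<bullet> H > 0)"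
proof -
  have lin: "linear (adjoint C)" using C by (rule adjoint_linear)
  have adj_Sym: "adjoint_Sym C K \<in> Sym" for K
    by (simp add: adjoint_Sym_eq[OF C] Sym_def transpose_simps add.commute)
  have adj: "H \<bullet> adjoint_Sym C K = C H \<bullet> K" if "H \<in> Sym" for H K
  proof -
    have "H \<bullet> transpose (adjoint C K) = H \<bullet> adjoint C K"
      using that inner_transpose_mat3[of H "adjoint C K"] by (simp add: Sym_def)
    then show ?thesis by (simp add: adjoint_Sym_eq[OF C] inner_add_right adjoint_works[OF C])
  qed
  have q: "sym_part C H \<bullet> H = C H \<bullet> H" if "H \<in> Sym" for H
    using adj[OF that, of H] by (simp add: sym_part_def inner_add_left inner_commute[of "adjoint_Sym C H"])
  have "sym_part C H \<bullet> K = H \<bullet> sym_part C K" if "H \<in> Sym" "K \<in> Sym" for H K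
    using adj[OF that(1), of K] adj[OF that(2), of H]
    by (simp add: sym_part_def inner_add_left inner_add_right inner_commute)
  moreover have "sym_part C (H + K) = sym_part C H + sym_part C K" for H K
    by (simp add: sym_part_def adjoint_Sym_eq[OF C] linear_add[OF C] linear_add[OF lin]
        transpose_simps scaleR_add_right)
  moreover have "sym_part C (c *\<^sub>R H) = c *\<^sub>R sym_part C H" for c H
    by (simp add: sym_part_def adjoint_Sym_eq[OF C] linear_cmul[OF C] linear_cmul[OF lin]
        transpose_simps scaleR_add_right mult.commute)
  moreover have "sym_part C H \<in> Sym" if "H \<in> Sym" for H
    unfolding sym_part_def by (intro Sym_simps adj_Sym maps that)
  ultimately show ?thesis using q by (simp add: Sym4_pp_def)
qed

text \<open>On \<open>Sym\<close> the law \<open>\<tau>_hat\<close> is the composition of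
  \<open>\<tau>\<close> with \<open>mat_exp\<close>, so the chain rule applies.\<close>

lemma logarithmic_law_has_derivative:
  assumes hat: "\<forall>V\<in>Sym_pp. \<tau>_hat (mat_log V) = \<tau> V"
    and T: "(\<tau> has_derivative T) (at (mat_exp S) within Sym_pp)"
    and E: "(mat_exp has_derivative E) (at S)" and S: "S \<in> Sym"
  shows "(\<tau>_hat has_derivative (\<lambda>H. T (E H))) (at S within Sym)"
proof (rule has_derivative_transform[OF S])
  show "\<tau>_hat X = \<tau> (mat_exp X)" if "X \<in> Sym" for X
    using bspec[OF hat mat_exp_Sym_pp[OF that]] by (simp add: mat_log_mat_exp[OF that])
  show "((\<lambda>X. \<tau> (mat_exp X)) has_derivative (\<lambda>H. T (E H))) (at S within Sym)"
    by (rule has_derivative_in_compose[OF has_derivative_at_withinI[OF E]])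
      (use T in \<open>simp add: mat_exp_image\<close>)
qed

section \<open>Test curves, monotonicity and the equivalence\<close>

lemma Sym_pp_GL_plus:
  assumes "V \<in> Sym_pp"
  shows "V \<in> GL_plus"
proof -
  obtain Q v where Q: "rotation_matrix Q" and V: "V = conj_mat Q (diag_mat v)" and v: "\<And>i. v $ i > 0"
    using Sym_pp_diagonalization[OF assms] by metis
  have "det V = v $ 1 * v $ 2 * v $ 3"
    using Q by (simp add: V conj_mat_def det_mul rotation_matrix_def) (simp add: det_3 diag_mat_def)
  then show ?thesis using v by (simp add: GL_plus_def)
qed

lemma Sym_pp_left_stretch: "V \<in> Sym_pp \<Longrightarrow> left_stretch V = V"
  using Sym_pp_subset_Sym mat_sqrt_square by (auto simp: left_stretch_def Sym_def)

lemma curve_with_given_stretching: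
  assumes V: "V \<in> Sym_pp" and D: "D \<in> Sym"
  obtains I F where "open I" "is_interval I" "F C1_differentiable_on I" "F ` I \<subseteq> GL_plus"
    "(0::real) \<in> I" "F 0 = V" "stretching F 0 = D"
proof -
  \<comment> \<open>The velocity \<open>D ** V\<close> makes the velocity gradient at 0 equal to
    \<open>D\<close>, which is symmetric and so equals the stretching. The interval is then shrunk
    until the determinant stays positive.\<close>
  define F where "F = (\<lambda>t. V + t *\<^sub>R (D ** V))"
  have F': "(F has_vector_derivative D ** V) (at t)" for t
    unfolding F_def by (rule segment_has_vector_derivative)
  have detV: "det V > 0" using Sym_pp_GL_plus[OF V] by (simp add: GL_plus_def)
  have "continuous_on UNIV (\<lambda>t. det (F t))"
    unfolding det_3 F_def by (intro continuous_intros)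
  then have "open {t. det (F t) > 0}"
    by (intro open_Collect_less continuous_on_const)
  moreover have "0 \<in> {t. det (F t) > 0}" using detV by (simp add: F_def)
  ultimately obtain e where e: "e > 0" "ball 0 e \<subseteq> {t. det (F t) > 0}"
    by (meson open_contains_ball)
  show ?thesis
  proof (rule that[of "ball 0 e" F])
    show "is_interval (ball (0::real) e)" by (simp add: is_interval_ball_real)
    show "F C1_differentiable_on ball 0 e"
      unfolding C1_differentiable_on_def using F' by (auto intro!: exI[of _ "\<lambda>_. D ** V"])
    show "F ` ball 0 e \<subseteq> GL_plus" using e(2) by (auto simp: GL_plus_def)
    have "velocity_gradient F 0 = D ** (V ** matrix_inv V)"
      by (simp add: velocity_gradient_def vector_derivative_at[OF F'] F_def matrix_mul_assoc)
    then have "velocity_gradient F 0 = D" using detV by (simp add: matrix_inv_right)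
    moreover have "transpose D = D" using D by (simp add: Sym_def)
    ultimately show "stretching F 0 = D"
      by (simp add: stretching_def scaleR_2[symmetric])
  qed (use e(1) in \<open>auto simp: F_def\<close>)
qed

text \<open>The segment from \<open>S2\<close> to \<open>S1\<close> stays in the subspace
  \<open>Sym\<close>, and along it the inner product of \<open>f\<close> with \<open>S1 - S2\<close>
  has positive derivative.\<close>

lemma strictly_monotone_on_Sym:
  assumes der: "\<And>S. S \<in> Sym \<Longrightarrow> (f has_derivative G S) (at S within Sym)"
    and pos: "\<And>S H. S \<in> Sym \<Longrightarrow> H \<in> Sym - {0} \<Longrightarrow> G S H \<bullet> H > 0"
    and S: "S1 \<in> Sym" "S2 \<in> Sym" "S1 \<noteq> S2"
  shows "(f S1 - f S2) \<bullet> (S1 - S2) > 0"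
proof -
  define H where "H = S1 - S2"
  have H: "H \<in> Sym - {0}" using S by (simp add: H_def Sym_simps)
  let ?c = "\<lambda>t. S2 + t *\<^sub>R H"
  have c: "?c t \<in> Sym" for t using S H by (simp add: Sym_simps)
  have "f (?c 0) \<bullet> H < f (?c 1) \<bullet> H"
  proof (rule DERIV_pos_imp_increasing[where f = "\<lambda>t. f (?c t) \<bullet> H"])
    fix t :: real
    have "((\<lambda>t. f (?c t)) has_vector_derivative G (?c t) H) (at t)"
      by (rule has_derivative_within_chain_curve[OF der[OF c] segment_has_vector_derivative])
        (simp add: c)
    from bounded_linear.has_vector_derivative[OF bounded_linear_inner_left this]
    have "DERIV (\<lambda>t. f (?c t) \<bullet> H) t :> G (?c t) H \<bullet> H"
      by (simp add: has_real_derivative_iff_has_vector_derivative)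
    then show "\<exists>y. DERIV (\<lambda>t. f (?c t) \<bullet> H) t :> y \<and> y > 0"
      using pos[OF c H] by blast
  qed simp
  then show ?thesis by (simp add: H_def inner_diff_left)
qed

theorem mainTheorem2:
  fixes \<sigma> \<tau> \<tau>_hat :: "mat3 \<Rightarrow> mat3"
  assumes maps: "\<forall>V\<in>Sym_pp. \<tau> V \<in> Sym"
    and kirchhoff: "\<forall>V\<in>Sym_pp. \<tau> V = det V *\<^sub>R \<sigma> V"
    and hat: "\<forall>V\<in>Sym_pp. \<tau>_hat (mat_log V) = \<tau> V"
    and C1: "C1_on Sym_pp \<tau>"
    and iso: "isotropic \<tau>"
  shows "((\<forall>I F. open I \<and> is_interval I \<and> F C1_differentiable_on I \<and> F ` I \<subseteq> GL_plus \<longrightarrow>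
              (\<forall>t\<in>I. stretching F t \<noteq> 0 \<longrightarrow>
                 ZJ_rate F (\<lambda>s. \<tau> (left_stretch (F s))) t \<bullet> stretching F t > 0))
          \<longleftrightarrow> (\<forall>V\<in>Sym_pp. sym_part (D_Sym \<tau>_hat (mat_log V)) \<in> Sym4_pp))
       \<and> ((\<forall>V\<in>Sym_pp. sym_part (D_Sym \<tau>_hat (mat_log V)) \<in> Sym4_pp) \<longrightarrow>
            (\<forall>V1\<in>Sym_pp. \<forall>V2\<in>Sym_pp. V1 \<noteq> V2 \<longrightarrow>
               (\<tau>_hat (mat_log V1) - \<tau>_hat (mat_log V2)) \<bullet> (mat_log V1 - mat_log V2) > 0))"
    (is "(?ZJ \<longleftrightarrow> ?TSTS) \<and> (?TSTS \<longrightarrow> ?Hill)")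
proof -
  obtain \<tau>' where "\<forall>V\<in>Sym_pp. (\<tau> has_derivative blinfun_apply (\<tau>' V)) (at V within Sym_pp)"
    using C1 unfolding C1_on_def by blast
  then obtain T where T: "\<And>V. V \<in> Sym_pp \<Longrightarrow> (\<tau> has_derivative T V) (at V within Sym_pp)"
    using that[of "\<lambda>V. blinfun_apply (\<tau>' V)"] by blast
  have hat_Sym: "\<tau>_hat S \<in> Sym" if "S \<in> Sym" for S
    using bspec[OF hat mat_exp_Sym_pp[OF that]] bspec[OF maps mat_exp_Sym_pp[OF that]]
    by (simp add: mat_log_mat_exp[OF that])
  have hat_derivative: "(\<tau>_hat has_derivative D_Sym \<tau>_hat S) (at S within Sym)" if S: "S \<in> Sym" for S
  proof -
    obtain Q s where "rotation_matrix Q" "S = conj_mat Q (diag_mat s)"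
      using symmetric_diagonalization[OF S] by blast
    then show ?thesis
      using D_Sym_has_derivative[OF logarithmic_law_has_derivative[OF hat T[OF mat_exp_Sym_pp[OF S]] _ S] S]
        mat_exp_has_derivative_spectral rotation_orthogonal by blast
  qed
  have stable_iff: "sym_part (D_Sym \<tau>_hat S) \<in> Sym4_pp \<longleftrightarrow> (\<forall>H\<in>Sym - {0}. D_Sym \<tau>_hat S H \<bullet> H > 0)"
    if S: "S \<in> Sym" for S
    by (intro sym_part_in_Sym4_pp_iff has_derivative_linear[OF hat_derivative[OF S]]
        has_derivative_Sym_closed[OF hat_derivative[OF S] S hat_Sym])
  \<comment> \<open>Pointwise core of the equivalence: \<open>K\<close> depends on \<open>V\<close>
    alone, and along every curve through left stretch \<open>V\<close> with stretching
    \<open>D\<close> the Zaremba-Jaumann rate is \<open>T V (K D)\<close>.\<close>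
  have corotational: "\<exists>K. (\<forall>D. V ** K D + K D ** V = D ** (V ** V) + (V ** V) ** D) \<and>
      (sym_part (D_Sym \<tau>_hat (mat_log V)) \<in> Sym4_pp \<longleftrightarrow> (\<forall>D\<in>Sym - {0}. T V (K D) \<bullet> D > 0))"
    if V: "V \<in> Sym_pp" for V
  proof -
    define S where "S = mat_log V"
    have S: "S \<in> Sym" "mat_exp S = V"
      unfolding S_def by (simp_all add: mat_log_Sym mat_exp_mat_log V)
    obtain Q s where Q: "rotation_matrix Q" and SQ: "S = conj_mat Q (diag_mat s)"
      using symmetric_diagonalization[OF S(1)] by blast
    note orth = rotation_orthogonal[OF Q]
    have VQ: "V = conj_mat Q (diag_mat (\<chi> i. exp (s $ i)))"
      using S(2) unfolding SQ mat_exp_conj_diag[OF orth] by simp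
    let ?M = "\<lambda>m H. conj_mat Q (spectral_mult m s (conj_mat (transpose Q) H))"
    have TV: "(\<tau> has_derivative T V) (at (mat_exp S) within Sym_pp)"
      using T[OF V] S(2) by simp
    have "D_Sym \<tau>_hat S H = T V (?M exp_dd H)" if "H \<in> Sym" for H
      by (rule D_Sym_eq[OF logarithmic_law_has_derivative[OF hat TV _ S(1)] S(1) that])
        (simp add: SQ mat_exp_has_derivative_spectral[OF orth])
    then have "sym_part (D_Sym \<tau>_hat S) \<in> Sym4_pp \<longleftrightarrow> (\<forall>D\<in>Sym - {0}. T V (?M lyapunov_mult D) \<bullet> D > 0)"
      unfolding stable_iff[OF S(1)]
      using isotropic_multiplier_positivity_iff[OF iso Q, of "T V" s] T[OF V] VQ by simp
    then show ?thesis
      using lyapunov_mult_solves[OF orth, of s] unfolding S_def VQ[symmetric]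
      by (intro exI[of _ "?M lyapunov_mult"]) blast
  qed
  have "?ZJ \<longleftrightarrow> ?TSTS"
  proof
    assume ZJ: ?ZJ
    show ?TSTS
    proof
      fix V assume V: "V \<in> Sym_pp"
      obtain K where K: "\<And>D. V ** K D + K D ** V = D ** (V ** V) + (V ** V) ** D"
        and iff: "sym_part (D_Sym \<tau>_hat (mat_log V)) \<in> Sym4_pp \<longleftrightarrow> (\<forall>D\<in>Sym - {0}. T V (K D) \<bullet> D > 0)"
        using corotational[OF V] by blast
      show "sym_part (D_Sym \<tau>_hat (mat_log V)) \<in> Sym4_pp"
        unfolding iff
      proof
        fix D assume D: "D \<in> Sym - {0}"
        obtain I F where IF: "open I" "is_interval I" "F C1_differentiable_on I" "F ` I \<subseteq> GL_plus"
          "(0::real) \<in> I" "F 0 = V" "stretching F 0 = D"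
          using curve_with_given_stretching[OF V] D by blast
        obtain F' where F': "(F has_vector_derivative F') (at 0)"
          using IF(3,5) unfolding C1_differentiable_on_def by blast
        have "eventually (\<lambda>s. F s \<in> GL_plus) (nhds 0)"
          using IF(1,4,5) unfolding eventually_nhds by blast
        then have "ZJ_rate F (\<lambda>s. \<tau> (left_stretch (F s))) 0 = T V (K D)"
          by (intro ZJ_rate_isotropic[OF iso T[OF V] F']) (simp_all add: IF Sym_pp_left_stretch V K)
        moreover have "ZJ_rate F (\<lambda>s. \<tau> (left_stretch (F s))) 0 \<bullet> stretching F 0 > 0"
          using ZJ IF D by blast
        ultimately show "T V (K D) \<bullet> D > 0" by (simp add: IF)
      qed
    qed
  next
    assume TSTS: ?TSTS
    show ?ZJ
    proof (intro allI impI ballI)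
      fix I :: "real set" and F t
      assume IF: "open I \<and> is_interval I \<and> F C1_differentiable_on I \<and> F ` I \<subseteq> GL_plus"
        and t: "t \<in> I" and D: "stretching F t \<noteq> 0"
      define V where "V = left_stretch (F t)"
      have V: "V \<in> Sym_pp" unfolding V_def using IF t by (intro left_stretch_Sym_pp) auto
      obtain K where K: "\<And>D. V ** K D + K D ** V = D ** (V ** V) + (V ** V) ** D"
        and pos: "\<forall>D\<in>Sym - {0}. T V (K D) \<bullet> D > 0"
        using corotational[OF V] TSTS V by blast
      obtain F' where F': "(F has_vector_derivative F') (at t)"
        using IF t unfolding C1_differentiable_on_def by blast
      have "eventually (\<lambda>s. F s \<in> GL_plus) (nhds t)"
        using IF t unfolding eventually_nhds by blast
      then have "ZJ_rate F (\<lambda>s. \<tau> (left_stretch (F s))) t = T V (K (stretching F t))"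
        by (intro ZJ_rate_isotropic[OF iso T[OF V] F']) (simp_all add: V_def[symmetric] K)
      then show "ZJ_rate F (\<lambda>s. \<tau> (left_stretch (F s))) t \<bullet> stretching F t > 0"
        using pos stretching_Sym D by simp
    qed
  qed
  moreover have "?TSTS \<longrightarrow> ?Hill"
  proof (intro impI ballI)
    fix V1 V2 assume TSTS: ?TSTS and V: "V1 \<in> Sym_pp" "V2 \<in> Sym_pp" "V1 \<noteq> V2"
    \<comment> \<open>Every symmetric \<open>S\<close> is the logarithm of \<open>mat_exp S\<close>,
      so positivity holds on all of \<open>Sym\<close>, in particular along segments between
      logarithms.\<close>
    have "D_Sym \<tau>_hat S H \<bullet> H > 0" if S: "S \<in> Sym" and "H \<in> Sym - {0}" for S H
      using TSTS mat_exp_Sym_pp[OF S] mat_log_mat_exp[OF S] stable_iff[OF S] that(2) by metis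
    then show "(\<tau>_hat (mat_log V1) - \<tau>_hat (mat_log V2)) \<bullet> (mat_log V1 - mat_log V2) > 0"
      by (intro strictly_monotone_on_Sym[OF hat_derivative])
        (use V mat_log_Sym mat_exp_mat_log in \<open>auto, metis\<close>)
  qed
  ultimately show ?thesis by blast
qed

end
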